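(* For every integer $k\ge2$, $\zeta(k)=\sum_{n\ge1}n^{-k}\in\bigcap_{\mu>0}\mathcal{Z}^\mu$, i.e. $\zeta(k)\in\mathcal{Z}^\mu$ for every real $\mu>0$.
   Context: For real $\mu>0$, $\mathbb{Q}[\mu]\subset\mathbb{R}$ is the ring generated by $\mu$. A bi-index $(\mathbf{k};\mathbf{m})=(k_1,\dots,k_r;m_1,\dots,m_r)\in\mathbb{N}^r\times\mathbb{Q}^r$ is admissible if all $m_i>0$ and $k_r>1$; then $\zeta^{\mu}(\mathbf{k};\mathbf{m})=\sum_{0\le n_1\le\cdots\le n_r}\frac{\mu^r}{(n_1\mu+m_1)^{k_1}\cdots(n_r\mu+m_r)^{k_r}}$. A special triple $(\mathbf{k};\mathbf{m};\tilde{\mathbf{m}})$ has $\mathbf{k}=(k_1,\dots,k_{r-1},1)$, $\mathbf{m}=(m_1,\dots,m_r)$, $\tilde{\mathbf{m}}=(m_1,\dots,m_{r-1},\tilde m_r)$, all entries in $\mathbb{Q}_{>0}$, $m_r\ne\tilde m_r$, and $\mathcal{D}^{\mu}(\mathbf{k};\mathbf{m};\tilde{\mathbf{m}})=(\tilde m_r-m_r)\sum_{0\le n_1\le\cdots\le n_r}\frac{\mu^r}{\prod_{i<r}(n_i\mu+m_i)^{k_i}(n_r\mu+m_r)(n_r\mu+\tilde m_r)}$. $\mathcal{Z}^\mu$ is the $\mathbb{Q}[\mu]$-span of $1$, all admissible $\zeta^\mu(\mathbf{k};\mathbf{m})$ and all $\mathcal{D}^\mu(\mathbf{k};\mathbf{m};\tilde{\mathbf{m}})$.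 *)

theory Defs
  imports "HOL-Analysis.Analysis" "HOL-Computational_Algebra.Polynomial"
begin

definition rat_adjoin :: "real \<Rightarrow> real set" where
  "rat_adjoin \<mu> = range (\<lambda>p :: rat poly. poly (map_poly of_rat p) \<mu>)"

text \<open>
  Indices of depth \<open>r\<close> are lists of length \<open>r\<close>, so that the \<open>i\<close>-th entry (counting from 1) is
  \<open>xs ! (i - 1)\<close>. The exponents range over the positive integers and the depth is at least 1.
\<close>

definition index_chains :: "nat \<Rightarrow> nat list set" where
  "index_chains r = {ns. length ns = r \<and> sorted ns}"

definition admissible :: "nat list \<Rightarrow> rat list \<Rightarrow> bool" where
  "admissible ks ms \<longleftrightarrow>
     ks \<noteq> [] \<and> length ms = length ks \<and>
     (\<forall>k\<in>set ks. k \<ge> 1) \<and> (\<forall>m\<in>set ms. m > 0) \<and> last ks > 1"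

text \<open>
  All terms of the two series below are positive for \<open>\<mu> > 0\<close> and positive shifts, so the unordered
  sum agrees with the multiple series under any order of summation.
\<close>

definition zeta_mu :: "real \<Rightarrow> nat list \<Rightarrow> rat list \<Rightarrow> real" where
  "zeta_mu \<mu> ks ms =
     (\<Sum>\<^sub>\<infinity>ns\<in>index_chains (length ks).
        \<mu> ^ length ks /
        (\<Prod>i<length ks. (real (ns ! i) * \<mu> + of_rat (ms ! i)) ^ (ks ! i)))"

definition special_triple :: "nat list \<Rightarrow> rat list \<Rightarrow> rat list \<Rightarrow> bool" where
  "special_triple ks ms ms' \<longleftrightarrow>
     ks \<noteq> [] \<and> length ms = length ks \<and> length ms' = length ks \<and>
     (\<forall>k\<in>set ks. k \<ge> 1) \<and> (\<forall>m\<in>set ms. m > 0) \<and> (\<forall>m\<in>set ms'. m > 0) \<and>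
     last ks = 1 \<and> butlast ms' = butlast ms \<and> last ms \<noteq> last ms'"

definition D_mu :: "real \<Rightarrow> nat list \<Rightarrow> rat list \<Rightarrow> rat list \<Rightarrow> real" where
  "D_mu \<mu> ks ms ms' =
     of_rat (last ms' - last ms) *
     (\<Sum>\<^sub>\<infinity>ns\<in>index_chains (length ks).
        \<mu> ^ length ks /
        ((\<Prod>i<length ks - 1. (real (ns ! i) * \<mu> + of_rat (ms ! i)) ^ (ks ! i)) *
         (real (last ns) * \<mu> + of_rat (last ms)) *
         (real (last ns) * \<mu> + of_rat (last ms'))))"

definition Z_generators :: "real \<Rightarrow> real set" where
  "Z_generators \<mu> =
     {1} \<union> {zeta_mu \<mu> ks ms | ks ms. admissible ks ms} \<union>
     {D_mu \<mu> ks ms ms' | ks ms ms'. special_triple ks ms ms'}"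

definition Z_space :: "real \<Rightarrow> real set" where
  "Z_space \<mu> =
     {\<Sum>x\<in>S. c x * x | S c. finite S \<and> S \<subseteq> Z_generators \<mu> \<and> (\<forall>x\<in>S. c x \<in> rat_adjoin \<mu>)}"

end

theory Submission
  imports
    Defs
    "HOL-Complex_Analysis.Complex_Analysis"
    "HOL-Computational_Algebra.Group_Closure"
    "HOL-Real_Asymp.Real_Asymp"
begin

text \<open>
  Put \<open>l = 1/\<mu>\<close>. On \<open>0 < v < 1\<close> consider iterated integrals of the two forms
  \<open>dv/(v (1 - v))\<close> and \<open>v\<^sup>l dv/(v (1 - v))\<close>, called \<open>F\<close> for a word in these letters; they multiply by
  the shuffle rule. If the outermost letter is the difference of the two forms, the limit
  \<open>v \<rightarrow> 1\<close> exists and is a value \<open>\<D>\<^sup>\<mu>\<close> with all exponents 1. Hence the additive group generated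
  by 1 and these values is a ring.

  Let \<open>V\<close> have density \<open>l v\<^bsup>l-1\<^esup>\<close> on \<open>(0,1)\<close> and let \<open>X = ln ((1 - V)/V)\<close>. The central moments of
  \<open>X\<close>, divided by factorials, are limits of integral combinations of the \<open>F\<close>, and the divergent parts
  cancel exactly so that they lie in that ring. By the Beta integral, the generating function
  \<open>E e\<^bsup>zX\<^esup>\<close> is \<open>\<Gamma>(1 + z) \<Gamma>(l - z)/\<Gamma>(l)\<close>, so the \<open>k\<close>-th cumulant of \<open>X\<close> is
  \<open>(k - 1)!\<close> times \<open>(-1)\<^sup>k \<zeta>(k) + \<Sum>\<^sub>n (n + l)\<^bsup>-k\<^esup>\<close>. Newton's recursion from moments to
  cumulants needs no division, so this number lies in the ring too, and
  \<open>\<Sum>\<^sub>n (n + l)\<^bsup>-k\<^esup> = \<mu>\<^bsup>k-1\<^esup> \<zeta>\<^sup>\<mu>(k;1)\<close>.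
\<close>

section \<open>Iterated integrals as power series\<close>

definition ones :: "bool list \<Rightarrow> nat" where
  "ones w = count_list w True"

lemma ones_simps [simp]: "ones [] = 0" "ones (True # w) = Suc (ones w)" "ones (False # w) = ones w"
  by (simp_all add: ones_def)

text \<open>
  In a word, \<open>True\<close> stands for \<open>v\<^sup>l dv/(v (1 - v))\<close> and \<open>False\<close> for \<open>dv/(v (1 - v))\<close>; the head is the
  outermost letter, i.e. the one integrated last. The iterated integral of \<open>w\<close> from 0 is
  \<open>\<Sum>\<^sub>n coef l w n v\<^bsup>n + l ones w\<^esup>\<close>.
\<close>

fun coef :: "real \<Rightarrow> bool list \<Rightarrow> nat \<Rightarrow> real" where
  "coef l [] n = (if n = 0 then 1 else 0)"
| "coef l (a # w) n = (\<Sum>i\<le>n. coef l w i) / (real n + l * real (ones (a # w)))"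

text \<open>The words whose iterated integral converges at \<open>v = 0\<close>.\<close>

definition regular_word :: "bool list \<Rightarrow> bool" where
  "regular_word w \<longleftrightarrow> (w \<noteq> [] \<longrightarrow> last w)"

lemma regular_word_Cons: "regular_word (a # w) \<longleftrightarrow> regular_word w \<and> (w = [] \<longrightarrow> a)"
  by (auto simp: regular_word_def)

lemma regular_word_Nil [simp]: "regular_word []"
  by (simp add: regular_word_def)

lemma ones_pos: "regular_word w \<Longrightarrow> w \<noteq> [] \<Longrightarrow> ones w \<ge> 1"
  by (induction w) (auto simp: regular_word_Cons ones_def split: if_splits)

text \<open>The coefficients of the series of \<open>w\<close> after division by
  \<open>1 - v\<close>; later also the inner sums of the multiple series.\<close>

definition csum :: "real \<Rightarrow> bool list \<Rightarrow> nat \<Rightarrow> real" where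
  "csum l w n = (\<Sum>i\<le>n. coef l w i)"

lemma coef_Cons: "coef l (a # w) n = csum l w n / (real n + l * real (ones (a # w)))"
  by (simp add: csum_def)

lemma coef_nonneg: "l > 0 \<Longrightarrow> coef l w n \<ge> 0"
  by (induction w arbitrary: n) (auto intro!: divide_nonneg_nonneg sum_nonneg add_nonneg_nonneg)

lemma csum_nonneg: "l > 0 \<Longrightarrow> csum l w n \<ge> 0"
  unfolding csum_def by (intro sum_nonneg coef_nonneg)

section \<open>Growth of the coefficients\<close>

text \<open>Telescoping: with \<open>b^2 = a^2 + 1\<close>, the inequality
  \<open>(b - a)^2 \<ge> 0\<close> gives \<open>1 / b \<le> 2 * (b - a)\<close>.\<close>

lemma sum_inverse_sqrt_le: "(\<Sum>i\<le>n. 1 / sqrt (real i + 1)) \<le> 2 * sqrt (real n + 1)"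
proof (induction n)
  case (Suc n)
  define a b where "a = sqrt (real n + 1)" and "b = sqrt (real (Suc n) + 1)"
  have "b * b = a * a + 1" "a > 0" "b > 0" by (simp_all add: a_def b_def)
  moreover have "0 \<le> (b - a) * (b - a)" by simp
  ultimately have "2 * a * b + 1 \<le> 2 * b * b" by (simp add: algebra_simps)
  hence "2 * a + 1 / b \<le> 2 * b" using \<open>b > 0\<close> by (simp add: field_simps)
  thus ?case using Suc unfolding a_def b_def by simp
qed simp

lemma add_mult_ge_min:
  assumes "l > 0" "m \<ge> 1"
  shows "real n + l * real m \<ge> min 1 l * (real n + 1)"
proof -
  have "min 1 l * real n \<le> 1 * real n" by (intro mult_right_mono) auto
  moreover have "min 1 l \<le> l * 1" by simp
  moreover have "l * 1 \<le> l * real m" using assms by (intro mult_left_mono) auto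
  ultimately show ?thesis by (simp add: algebra_simps)
qed

text \<open>The true order is a power of \<open>ln n\<close>, but square-root growth reproduces
  itself under the recursion: division by a multiple of \<open>n + 1\<close> leaves
  \<open>1 / sqrt (n + 1)\<close>, whose sums are again of order \<open>sqrt n\<close>. Any exponent
  below 1 is good enough for the convergence of \<open>Dint\<close>.\<close>

lemma csum_le:
  assumes "l > 0" "regular_word w"
  shows "csum l w n \<le> (2 / min 1 l) ^ length w * sqrt (real n + 1)"
  using assms(2)
proof (induction w arbitrary: n)
  case Nil
  have "csum l [] n = 1" by (simp add: csum_def)
  thus ?case by simp
next
  case (Cons a w)
  let ?K = "(2 / min 1 l) ^ length w"
  have m: "ones (a # w) \<ge> 1" using ones_pos[OF Cons.prems] by simp
  have l: "min 1 l > 0" using assms by simp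
  have "csum l (a # w) n \<le> (\<Sum>i\<le>n. ?K / min 1 l * (1 / sqrt (real i + 1)))"
    unfolding csum_def
  proof (rule sum_mono)
    fix i assume "i \<in> {..n}"
    have pos: "min 1 l * (real i + 1) > 0" using l by simp
    have "coef l (a # w) i \<le> (?K * sqrt (real i + 1)) / (min 1 l * (real i + 1))"
      unfolding coef_Cons using Cons.IH[of i] Cons.prems add_mult_ge_min[OF assms(1) m, of i] pos
      by (intro frac_le mult_nonneg_nonneg zero_le_power) (use l in \<open>auto simp: regular_word_Cons\<close>)
    also have "\<dots> = ?K / min 1 l * (sqrt (real i + 1) / (real i + 1))"
      by simp
    also have "sqrt (real i + 1) / (real i + 1) = 1 / sqrt (real i + 1)"
      by (simp add: real_div_sqrt field_simps)
    finally show "coef l (a # w) i \<le> ?K / min 1 l * (1 / sqrt (real i + 1))" .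
  qed
  also have "\<dots> = ?K / min 1 l * (\<Sum>i\<le>n. 1 / sqrt (real i + 1))"
    by (simp only: sum_distrib_left)
  also have "\<dots> \<le> ?K / min 1 l * (2 * sqrt (real n + 1))"
    using l by (intro mult_left_mono sum_inverse_sqrt_le) auto
  finally show ?case by (simp add: field_simps)
qed

lemma coef_le_csum: "l > 0 \<Longrightarrow> coef l w n \<le> csum l w n"
  unfolding csum_def by (rule member_le_sum) (auto intro: coef_nonneg)

lemma summable_coef_power:
  assumes "l > 0" "regular_word w" "\<bar>v\<bar> < 1"
  shows "summable (\<lambda>n. coef l w n * v ^ n)"
proof (rule summable_comparison_test)
  let ?K = "(2 / min 1 l) ^ length w"
  show "\<exists>N. \<forall>n\<ge>N. norm (coef l w n * v ^ n) \<le> ?K * (real (Suc n) * \<bar>v\<bar> ^ n)"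
  proof (intro exI allI impI)
    fix n :: nat
    have "sqrt (real n + 1) \<le> real n + 1"
      by (rule real_le_lsqrt) (auto simp: power2_eq_square algebra_simps)
    hence "?K * sqrt (real n + 1) \<le> ?K * real (Suc n)"
      using assms(1) by (intro mult_left_mono zero_le_power) auto
    hence "coef l w n \<le> ?K * real (Suc n)"
      using coef_le_csum[OF assms(1), of w n] csum_le[OF assms(1,2), of n] by linarith
    hence "coef l w n * \<bar>v\<bar> ^ n \<le> ?K * real (Suc n) * \<bar>v\<bar> ^ n"
      by (intro mult_right_mono) auto
    thus "norm (coef l w n * v ^ n) \<le> ?K * (real (Suc n) * \<bar>v\<bar> ^ n)"
      using coef_nonneg[OF assms(1), of w n] by (simp only: real_norm_def abs_mult power_abs mult.assoc abs_of_nonneg)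
  qed
  \<comment> \<open>\<open>diffs (\<lambda>_. 1) n\<close> is \<open>n + 1\<close>, so the majorant
    is the differentiated geometric series.\<close>
  have "summable (\<lambda>n. diffs (\<lambda>_. 1) n * \<bar>v\<bar> ^ n)"
    by (rule termdiff_converges[of _ 1]) (use assms in \<open>auto intro!: summable_geometric\<close>)
  thus "summable (\<lambda>n. ?K * (real (Suc n) * \<bar>v\<bar> ^ n))"
    by (intro summable_mult) (simp add: diffs_def)
qed

section \<open>Iterated integrals as functions on \<open>(0, 1)\<close>\<close>

definition iterint :: "real \<Rightarrow> bool list \<Rightarrow> real \<Rightarrow> real" where
  "iterint l w v = v powr (l * real (ones w)) * (\<Sum>n. coef l w n * v ^ n)"

definition letter :: "real \<Rightarrow> bool \<Rightarrow> real \<Rightarrow> real" where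
  "letter l a v = (if a then v powr l else 1)"

lemma iterint_Nil: "v > 0 \<Longrightarrow> iterint l [] v = 1"
  using suminf_finite[of "{0}" "\<lambda>n. coef l [] n * v ^ n"] by (simp add: iterint_def)

text \<open>Cauchy product with the geometric series: this is the factor \<open>1 / (1 - v)\<close>
  of both forms.\<close>

lemma csum_sums:
  assumes "l > 0" "regular_word w" "\<bar>v\<bar> < 1"
  shows "(\<lambda>n. csum l w n * v ^ n) sums ((\<Sum>n. coef l w n * v ^ n) / (1 - v))"
proof -
  have "summable (\<lambda>n. norm (coef l w n * v ^ n))"
    using summable_coef_power[of l w "\<bar>v\<bar>"] assms coef_nonneg[OF assms(1)]
    by (simp add: abs_mult power_abs)
  from Cauchy_product_sums[OF this, of "\<lambda>n. v ^ n"]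
  have "(\<lambda>n. \<Sum>i\<le>n. coef l w i * v ^ i * v ^ (n - i)) sums
          ((\<Sum>n. coef l w n * v ^ n) * (\<Sum>n. v ^ n))"
    using assms by (auto simp: power_abs)
  moreover have "(\<Sum>i\<le>n. coef l w i * v ^ i * v ^ (n - i)) = csum l w n * v ^ n" for n
    unfolding csum_def sum_distrib_right
    by (rule sum.cong) (auto simp flip: power_add simp: mult.assoc)
  ultimately show ?thesis using assms by (simp add: suminf_geometric divide_inverse)
qed

text \<open>The recursion of \<open>coef\<close> is this differential equation read coefficientwise:
  differentiation multiplies the \<open>n\<close>-th coefficient by \<open>n + m\<close>, which
  cancels the denominator and leaves \<open>csum\<close>. Together with the limit 0 at 0 it
  identifies \<open>iterint\<close> as an iterated integral.\<close>

lemma has_real_derivative_iterint: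
  assumes "l > 0" "regular_word (a # w)" "0 < v" "v < 1"
  shows "(iterint l (a # w) has_real_derivative letter l a v * iterint l w v / (v * (1 - v))) (at v)"
proof -
  define m where "m = l * real (ones (a # w))"
  define c where "c = coef l (a # w)"
  define S where "S = (\<Sum>n. c n * v ^ n)"
  have w: "regular_word w" using assms(2) by (simp add: regular_word_Cons)
  have m: "m > 0" using ones_pos[OF assms(2)] assms(1) by (auto simp: m_def)
  have *: "((\<lambda>v. \<Sum>n. c n * v ^ n) has_real_derivative (\<Sum>n. diffs c n * v ^ n)) (at v)"
    unfolding c_def
    by (rule termdiffs_strong'[of 1]) (use assms summable_coef_power[OF assms(1,2)] in auto)
  have "((\<lambda>v. v powr m * (\<Sum>n. c n * v ^ n)) has_real_derivative
          m * v powr (m - 1) * S + v powr m * (\<Sum>n. diffs c n * v ^ n)) (at v)"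
    by (rule derivative_eq_intros refl * | use assms in \<open>simp add: S_def\<close>)+
  also have "v powr m = v powr (m - 1) * v"
    using assms by (simp add: powr_diff)
  also have "m * v powr (m - 1) * S + v powr (m - 1) * v * (\<Sum>n. diffs c n * v ^ n) =
             v powr (m - 1) * (m * S + v * (\<Sum>n. diffs c n * v ^ n))"
    by (simp add: algebra_simps)
  also have "m * S + v * (\<Sum>n. diffs c n * v ^ n) = (\<Sum>n. coef l w n * v ^ n) / (1 - v)"
  proof -
    have s1: "(\<lambda>n. m * (c n * v ^ n)) sums (m * S)"
      unfolding S_def c_def using summable_coef_power[OF assms(1,2), of v] assms
      by (intro sums_mult summable_sums) auto
    have "summable (\<lambda>n. diffs c n * v ^ n)"
      unfolding c_def
      by (rule termdiff_converges[of _ 1]) (use assms summable_coef_power[OF assms(1,2)] in auto)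
    hence "(\<lambda>n. real n * c n * v ^ (n - Suc 0)) sums (\<Sum>n. diffs c n * v ^ n)"
      by (rule diffs_equiv)
    hence "(\<lambda>n. v * (real n * c n * v ^ (n - Suc 0))) sums (v * (\<Sum>n. diffs c n * v ^ n))"
      by (rule sums_mult)
    also have "(\<lambda>n. v * (real n * c n * v ^ (n - Suc 0))) = (\<lambda>n. real n * c n * v ^ n)"
    proof
      fix n show "v * (real n * c n * v ^ (n - Suc 0)) = real n * c n * v ^ n"
        by (cases n) auto
    qed
    finally have "(\<lambda>n. m * (c n * v ^ n) + real n * c n * v ^ n) sums
                    (m * S + v * (\<Sum>n. diffs c n * v ^ n))"
      by (intro sums_add s1)
    also have "(\<lambda>n. m * (c n * v ^ n) + real n * c n * v ^ n) = (\<lambda>n. csum l w n * v ^ n)"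
    proof
      fix n
      have "real n + m > 0" using m by linarith
      hence "(real n + m) * c n = csum l w n"
        unfolding c_def coef_Cons m_def by simp
      thus "m * (c n * v ^ n) + real n * c n * v ^ n = csum l w n * v ^ n"
        by (metis (no_types, lifting) add.commute distrib_right mult.assoc)
    qed
    finally show ?thesis
      using csum_sums[OF assms(1) w, of v] assms by (intro sums_unique2) auto
  qed
  also have "v powr (m - 1) * ((\<Sum>n. coef l w n * v ^ n) / (1 - v)) =
             letter l a v * iterint l w v / (v * (1 - v))"
    using assms by (cases a)
      (simp_all add: iterint_def letter_def m_def powr_diff powr_add field_simps)
  finally show ?thesis unfolding iterint_def m_def c_def .
qed

text \<open>A nonempty regular word contains \<open>True\<close>, so the prefactor has a positive
  exponent.\<close>

lemma iterint_tendsto_0: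
  assumes "l > 0" "regular_word w" "w \<noteq> []"
  shows "(iterint l w \<longlongrightarrow> 0) (at_right 0)"
proof -
  have "isCont (\<lambda>v. \<Sum>n. coef l w n * v ^ n) 0"
    by (rule isCont_powser[of _ "1/2"]) (use summable_coef_power[OF assms(1,2), of "1/2"] in auto)
  hence "((\<lambda>v. \<Sum>n. coef l w n * v ^ n) \<longlongrightarrow> (\<Sum>n. coef l w n * 0 ^ n)) (at_right 0)"
    unfolding isCont_def by (rule filterlim_mono) (auto simp: at_le)
  moreover have "l * real (ones w) > 0"
    using ones_pos[OF assms(2,3)] assms(1) by simp
  hence "((\<lambda>v. v powr (l * real (ones w))) \<longlongrightarrow> 0) (at_right 0)"
    by (intro tendsto_zero_powrI tendsto_ident_at tendsto_const eventually_at_rightI[of 0 1]) auto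
  ultimately show ?thesis
    unfolding iterint_def by (auto intro: tendsto_eq_intros)
qed

section \<open>Uniqueness from the derivative, and the shuffle product\<close>

text \<open>The identities between iterated integrals below rest on this: the difference is constant
  on \<open>(0, 1)\<close>, and the common limit at 0 forces the constant to vanish.\<close>

lemma eq_if_same_derivative:
  fixes f g :: "real \<Rightarrow> real"
  assumes f: "\<And>x. 0 < x \<Longrightarrow> x < 1 \<Longrightarrow> (f has_real_derivative d x) (at x)"
  assumes g: "\<And>x. 0 < x \<Longrightarrow> x < 1 \<Longrightarrow> (g has_real_derivative d x) (at x)"
  assumes f0: "(f \<longlongrightarrow> c) (at_right 0)" and g0: "(g \<longlongrightarrow> c) (at_right 0)"
  assumes v: "0 < v" "v < 1"
  shows "f v = g v"
proof -
  define h where "h x = f x - g x" for x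
  have h': "(h has_real_derivative 0) (at x)" if "0 < x" "x < 1" for x
    unfolding h_def using DERIV_diff[OF f[OF that] g[OF that]] by simp
  have "\<exists>c. \<forall>x\<in>{0<..<1}. h x = c"
    by (rule has_field_derivative_zero_constant)
       (auto intro: has_field_derivative_at_within h')
  then obtain k where k: "\<And>x. 0 < x \<Longrightarrow> x < 1 \<Longrightarrow> h x = k" by auto
  have "(h \<longlongrightarrow> 0) (at_right 0)"
    unfolding h_def using tendsto_diff[OF f0 g0] by simp
  moreover have "\<forall>\<^sub>F x in at_right 0. h x = k"
    by (rule eventually_at_rightI[of 0 1]) (auto intro: k)
  ultimately have "((\<lambda>_. k) \<longlongrightarrow> 0) (at_right (0::real))"
    by (simp add: tendsto_cong)
  hence "k = 0" by (simp add: tendsto_const_iff)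
  thus ?thesis using k[OF v] by (simp add: h_def)
qed

text \<open>A list of words instead of a set, because the shuffle product counts interleavings with
  multiplicity.\<close>

fun shuffle_list :: "'a list \<Rightarrow> 'a list \<Rightarrow> 'a list list" where
  "shuffle_list [] ys = [ys]"
| "shuffle_list xs [] = [xs]"
| "shuffle_list (x # xs) (y # ys) =
     map ((#) x) (shuffle_list xs (y # ys)) @ map ((#) y) (shuffle_list (x # xs) ys)"

lemma shuffle_list_Nil2 [simp]: "shuffle_list xs [] = [xs]"
  by (cases xs) auto

lemma length_shuffle_list: "zs \<in> set (shuffle_list xs ys) \<Longrightarrow> length zs = length xs + length ys"
  by (induction xs ys arbitrary: zs rule: shuffle_list.induct) auto

text \<open>The last letter of a shuffle is the last letter of one of the two words.\<close>

lemma regular_word_shuffle_list: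
  "regular_word xs \<Longrightarrow> regular_word ys \<Longrightarrow> zs \<in> set (shuffle_list xs ys) \<Longrightarrow> regular_word zs"
proof (induction xs ys arbitrary: zs rule: shuffle_list.induct)
  case (3 x xs y ys)
  from 3(5) consider z where "zs = x # z" "z \<in> set (shuffle_list xs (y # ys))"
    | z where "zs = y # z" "z \<in> set (shuffle_list (x # xs) ys)" by auto
  thus ?case
  proof cases
    case 1
    have "regular_word z"
      by (rule 3(1)[OF _ _ 1(2)]) (use 3(3,4) in \<open>auto simp: regular_word_Cons\<close>)
    thus ?thesis using length_shuffle_list[OF 1(2)] 1(1) by (auto simp: regular_word_Cons)
  next
    case 2
    have "regular_word z"
      by (rule 3(2)[OF _ _ 2(2)]) (use 3(3,4) in \<open>auto simp: regular_word_Cons\<close>)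
    thus ?thesis using length_shuffle_list[OF 2(2)] 2(1) by (auto simp: regular_word_Cons)
  qed
qed auto

lemma has_real_derivative_sum_list:
  assumes "\<And>x. x \<in> set xs \<Longrightarrow> (f x has_real_derivative g x) F"
  shows "((\<lambda>v. \<Sum>x\<leftarrow>xs. f x v) has_real_derivative (\<Sum>x\<leftarrow>xs. g x)) F"
  using assms by (induction xs) (auto intro!: derivative_eq_intros)

lemma tendsto_sum_list:
  fixes f :: "'a \<Rightarrow> 'b \<Rightarrow> real"
  assumes "\<And>x. x \<in> set xs \<Longrightarrow> (f x \<longlongrightarrow> g x) F"
  shows "((\<lambda>v. \<Sum>x\<leftarrow>xs. f x v) \<longlongrightarrow> (\<Sum>x\<leftarrow>xs. g x)) F"
  using assms by (induction xs) (auto intro!: tendsto_intros)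

lemma tendsto_sum_list_0:
  fixes f :: "'a \<Rightarrow> 'b \<Rightarrow> real"
  assumes "\<And>x. x \<in> set xs \<Longrightarrow> (f x \<longlongrightarrow> 0) F"
  shows "((\<lambda>v. \<Sum>x\<leftarrow>xs. f x v) \<longlongrightarrow> 0) F"
  using tendsto_sum_list[of xs f "\<lambda>_. 0" F] assms by simp

lemma has_real_derivative_iterint_Cons_sum_list:
  assumes "l > 0" "\<And>x. x \<in> set xs \<Longrightarrow> regular_word (a # x)" "0 < v" "v < 1"
  shows "((\<lambda>v. \<Sum>x\<leftarrow>xs. iterint l (a # x) v) has_real_derivative
           letter l a v * (\<Sum>x\<leftarrow>xs. iterint l x v) / (v * (1 - v))) (at v)"
proof -
  have "letter l a v * (\<Sum>x\<leftarrow>xs. iterint l x v) / (v * (1 - v)) =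
        (\<Sum>x\<leftarrow>xs. letter l a v * iterint l x v / (v * (1 - v)))"
    by (induction xs) (auto simp: distrib_left add_divide_distrib)
  thus ?thesis
    using assms by (auto intro!: has_real_derivative_sum_list has_real_derivative_iterint)
qed

text \<open>Leibniz rule: differentiating the product strips the outermost letter from one factor or
  the other, which is the recursion of \<open>shuffle_list\<close>.\<close>

lemma iterint_shuffle:
  assumes "l > 0" "regular_word u" "regular_word w" "0 < v" "v < 1"
  shows "iterint l u v * iterint l w v = (\<Sum>x\<leftarrow>shuffle_list u w. iterint l x v)"
  using assms(2-5)
proof (induction u w arbitrary: v rule: shuffle_list.induct)
  case (1 ys)
  thus ?case by (simp add: iterint_Nil)
next
  case (2 x xs)
  thus ?case by (simp add: iterint_Nil)
next
  case (3 a u b w)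
  let ?X = "shuffle_list u (b # w)" and ?Y = "shuffle_list (a # u) w"
  have reg: "regular_word u" "regular_word w"
    using 3 by (auto simp: regular_word_Cons)
  have X: "regular_word (a # x)" if "x \<in> set ?X" for x
    by (rule regular_word_shuffle_list[OF 3(3,4)]) (use that in auto)
  have Y: "regular_word (b # x)" if "x \<in> set ?Y" for x
    by (rule regular_word_shuffle_list[OF 3(3,4)]) (use that in auto)
  have "iterint l (a # u) v * iterint l (b # w) v =
          (\<Sum>x\<leftarrow>?X. iterint l (a # x) v) + (\<Sum>x\<leftarrow>?Y. iterint l (b # x) v)"
  proof (rule eq_if_same_derivative[where c = 0, OF _ _ _ _ 3(5,6)])
    fix v :: real assume v: "0 < v" "v < 1"
    show "((\<lambda>v. iterint l (a # u) v * iterint l (b # w) v) has_real_derivative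
            letter l a v * (iterint l u v * iterint l (b # w) v) / (v * (1 - v)) +
            letter l b v * (iterint l (a # u) v * iterint l w v) / (v * (1 - v))) (at v)"
      by (rule derivative_eq_intros has_real_derivative_iterint assms(1) 3 v refl)+
         (simp add: algebra_simps)
    show "((\<lambda>v. (\<Sum>x\<leftarrow>?X. iterint l (a # x) v) + (\<Sum>x\<leftarrow>?Y. iterint l (b # x) v))
            has_real_derivative
            letter l a v * (iterint l u v * iterint l (b # w) v) / (v * (1 - v)) +
            letter l b v * (iterint l (a # u) v * iterint l w v) / (v * (1 - v))) (at v)"
      unfolding 3(1)[OF reg(1) 3(4) v] 3(2)[OF 3(3) reg(2) v]
      by (intro DERIV_add has_real_derivative_iterint_Cons_sum_list assms(1) v X Y)
  next
    show "((\<lambda>v. iterint l (a # u) v * iterint l (b # w) v) \<longlongrightarrow> 0) (at_right 0)"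
      by (intro tendsto_mult_zero iterint_tendsto_0 assms(1) 3(3,4)) auto
    show "((\<lambda>v. (\<Sum>x\<leftarrow>?X. iterint l (a # x) v) + (\<Sum>x\<leftarrow>?Y. iterint l (b # x) v)) \<longlongrightarrow> 0) (at_right 0)"
      by (intro tendsto_add_zero tendsto_sum_list_0 iterint_tendsto_0 assms(1) X Y) auto
  qed
  thus ?case by (simp add: o_def)
qed

section \<open>The ring of limit values\<close>

text \<open>The outermost form is \<open>(1 - v^l) dv / (v (1 - v))\<close>, whose pole at
  \<open>v = 1\<close> is cancelled by the numerator.\<close>

definition diffint :: "real \<Rightarrow> bool list \<Rightarrow> real \<Rightarrow> real" where
  "diffint l w v = iterint l (False # w) v - iterint l (True # w) v"

lemma has_real_derivative_diffint:
  assumes "l > 0" "regular_word w" "w \<noteq> []" "0 < v" "v < 1"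
  shows "(diffint l w has_real_derivative
           (1 - v powr l) * iterint l w v / (v * (1 - v))) (at v)"
proof -
  have r: "regular_word (a # w)" for a using assms by (simp add: regular_word_Cons)
  show ?thesis unfolding diffint_def
    using DERIV_diff[OF has_real_derivative_iterint[OF assms(1) r assms(4,5), of False]
        has_real_derivative_iterint[OF assms(1) r assms(4,5), of True]]
    by (simp add: letter_def algebra_simps diff_divide_distrib)
qed

lemma diffint_tendsto_0:
  assumes "l > 0" "regular_word w" "w \<noteq> []"
  shows "(diffint l w \<longlongrightarrow> 0) (at_right 0)"
proof -
  have r: "regular_word (a # w)" for a using assms by (simp add: regular_word_Cons)
  show ?thesis unfolding diffint_def
    using tendsto_diff[OF iterint_tendsto_0[OF assms(1) r, of False] iterint_tendsto_0[OF assms(1) r, of True]]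
    by simp
qed

lemma has_real_derivative_diffint_sum_list:
  assumes "l > 0" "\<And>x. x \<in> set xs \<Longrightarrow> regular_word x \<and> x \<noteq> []" "0 < v" "v < 1"
  shows "((\<lambda>v. \<Sum>x\<leftarrow>xs. diffint l x v) has_real_derivative
           (1 - v powr l) * (\<Sum>x\<leftarrow>xs. iterint l x v) / (v * (1 - v))) (at v)"
proof -
  have "(1 - v powr l) * (\<Sum>x\<leftarrow>xs. iterint l x v) / (v * (1 - v)) =
        (\<Sum>x\<leftarrow>xs. (1 - v powr l) * iterint l x v / (v * (1 - v)))"
    by (induction xs) (auto simp: distrib_left add_divide_distrib)
  thus ?thesis
    using assms by (auto intro!: has_real_derivative_sum_list has_real_derivative_diffint)
qed

lemma regular_shuffle_list_nonempty:
  assumes "regular_word u" "regular_word w" "u \<noteq> [] \<or> w \<noteq> []" "x \<in> set (shuffle_list u w)"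
  shows "regular_word x \<and> x \<noteq> []"
  using regular_word_shuffle_list[OF assms(1,2,4)] length_shuffle_list[OF assms(4)] assms(3) by auto

text \<open>By the Leibniz rule the product again has the difference form outermost; under it stand
  \<open>iterint l u\<close> times \<open>diffint l w\<close> and the symmetric term, which are
  differences of ordinary products and can be shuffled. Hence products of limit values will be
  integer combinations of limit values.\<close>

lemma diffint_shuffle:
  assumes l: "l > 0" and u: "regular_word u" "u \<noteq> []" and w: "regular_word w" "w \<noteq> []"
    and v: "0 < v" "v < 1"
  shows "diffint l u v * diffint l w v =
           (\<Sum>x\<leftarrow>shuffle_list u (False # w). diffint l x v) -
           (\<Sum>x\<leftarrow>shuffle_list u (True # w). diffint l x v) +
           ((\<Sum>x\<leftarrow>shuffle_list (False # u) w. diffint l x v) -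
            (\<Sum>x\<leftarrow>shuffle_list (True # u) w. diffint l x v))"
proof (rule eq_if_same_derivative[where c = 0, OF _ _ _ _ v])
  have uw: "regular_word (a # u)" "regular_word (a # w)" for a
    using u w by (simp_all add: regular_word_Cons)
  let ?d = "\<lambda>v. (1 - v powr l) * iterint l u v / (v * (1 - v)) * diffint l w v +
                (1 - v powr l) * iterint l w v / (v * (1 - v)) * diffint l u v"
  {
    fix v :: real assume v: "0 < v" "v < 1"
    show "((\<lambda>v. diffint l u v * diffint l w v) has_real_derivative ?d v) (at v)"
      by (rule DERIV_mult has_real_derivative_diffint l u w v)+
    have d: "?d v =
        (1 - v powr l) * (\<Sum>x\<leftarrow>shuffle_list u (False # w). iterint l x v) / (v * (1 - v)) -
        (1 - v powr l) * (\<Sum>x\<leftarrow>shuffle_list u (True # w). iterint l x v) / (v * (1 - v)) +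
        ((1 - v powr l) * (\<Sum>x\<leftarrow>shuffle_list (False # u) w. iterint l x v) / (v * (1 - v)) -
         (1 - v powr l) * (\<Sum>x\<leftarrow>shuffle_list (True # u) w. iterint l x v) / (v * (1 - v)))"
      unfolding iterint_shuffle[OF l u(1) uw(2) v, symmetric]
        iterint_shuffle[OF l uw(1) w(1) v, symmetric] diffint_def
      by (simp add: algebra_simps diff_divide_distrib)
    show "((\<lambda>v. (\<Sum>x\<leftarrow>shuffle_list u (False # w). diffint l x v) -
           (\<Sum>x\<leftarrow>shuffle_list u (True # w). diffint l x v) +
           ((\<Sum>x\<leftarrow>shuffle_list (False # u) w. diffint l x v) -
            (\<Sum>x\<leftarrow>shuffle_list (True # u) w. diffint l x v))) has_real_derivative ?d v) (at v)"
      unfolding d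
      by (intro DERIV_add DERIV_diff has_real_derivative_diffint_sum_list l v;
          rule regular_shuffle_list_nonempty; use u w uw in blast)
  }
  show "((\<lambda>v. diffint l u v * diffint l w v) \<longlongrightarrow> 0) (at_right 0)"
    by (intro tendsto_mult_zero diffint_tendsto_0 l u w)
  have *: "((\<lambda>v. \<Sum>x\<leftarrow>shuffle_list a b. diffint l x v) \<longlongrightarrow> 0) (at_right 0)"
    if "regular_word a" "regular_word b" "a \<noteq> []" for a b
    by (rule tendsto_sum_list_0)
       (use diffint_tendsto_0[OF l] regular_shuffle_list_nonempty[OF that(1,2)] that(3) in blast)
  show "((\<lambda>v. (\<Sum>x\<leftarrow>shuffle_list u (False # w). diffint l x v) -
           (\<Sum>x\<leftarrow>shuffle_list u (True # w). diffint l x v) +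
           ((\<Sum>x\<leftarrow>shuffle_list (False # u) w. diffint l x v) -
            (\<Sum>x\<leftarrow>shuffle_list (True # u) w. diffint l x v))) \<longlongrightarrow> 0) (at_right 0)"
    using tendsto_add[OF tendsto_diff[OF *[OF u(1) uw(2)] *[OF u(1) uw(2)]]
         tendsto_diff[OF *[OF uw(1) w(1)] *[OF uw(1) w(1)]], of False True False True] u by simp
qed

section \<open>Limits at \<open>v = 1\<close>\<close>

text \<open>The series of \<open>diffint l w\<close> at \<open>v = 1\<close>. The two fractions stay
  together because the sum over either one alone diverges.\<close>

definition Dint :: "real \<Rightarrow> bool list \<Rightarrow> real" where
  "Dint l w = (\<Sum>n. csum l w n *
     (1 / (real n + l * real (ones w)) - 1 / (real n + l * real (Suc (ones w)))))"

text \<open>The difference increases in \<open>v\<close>, its derivative being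
  \<open>v powr (a - 1) - v powr (b - 1)\<close>; so its value at 1 is a majorant independent of
  \<open>v\<close>.\<close>

lemma powr_divide_diff_bounds:
  fixes a b v :: real
  assumes "0 < a" "a \<le> b" "0 < v" "v < 1"
  shows "0 \<le> v powr a / a - v powr b / b" "v powr a / a - v powr b / b \<le> 1 / a - 1 / b"
proof -
  have "v powr b \<le> v powr a" using assms by (intro powr_mono') auto
  hence "v powr b / b \<le> v powr a / a" using assms by (intro frac_le) auto
  thus "0 \<le> v powr a / a - v powr b / b" by simp
  have "v powr a / a - v powr b / b \<le> 1 powr a / a - 1 powr b / b"
  proof (rule DERIV_nonneg_imp_nondecreasing[of v 1])
    fix x assume x: "v \<le> x" "x \<le> 1"
    have "((\<lambda>v. v powr a / a - v powr b / b) has_real_derivative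
            x powr (a - 1) - x powr (b - 1)) (at x)"
      using assms x by (auto intro!: derivative_eq_intros)
    moreover have "x powr (b - 1) \<le> x powr (a - 1)"
      using assms x by (intro powr_mono') auto
    ultimately show "\<exists>y. ((\<lambda>v. v powr a / a - v powr b / b) has_real_derivative y) (at x) \<and> 0 \<le> y"
      by (auto intro!: exI)
  qed (use assms in auto)
  thus "v powr a / a - v powr b / b \<le> 1 / a - 1 / b" by simp
qed

text \<open>The difference of the fractions is of order \<open>1 / n^2\<close> and
  \<open>csum\<close> at most of order \<open>sqrt n\<close>, which leaves terms of order at most
  \<open>n powr (-3/2)\<close>.\<close>

lemma Dint_terms:
  assumes l: "l > 0" and w: "regular_word w" "w \<noteq> []"
  shows "csum l w n * (1 / (real n + l * real (ones w)) - 1 / (real n + l * real (Suc (ones w)))) \<ge> 0"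
    and "summable (\<lambda>n. csum l w n *
           (1 / (real n + l * real (ones w)) - 1 / (real n + l * real (Suc (ones w)))))"
proof -
  define m where "m = ones w"
  have m: "m \<ge> 1" using ones_pos[OF w] by (simp add: m_def)
  define K where "K = (2 / min 1 l) ^ length w * (l / (min 1 l)^2)"
  have K: "K \<ge> 0" using l by (auto simp: K_def)
  have *: "0 \<le> 1 / (real n + l * real m) - 1 / (real n + l * real (Suc m))" for n
  proof -
    have "0 < l * real m" using l m by simp
    thus ?thesis using l by (auto intro!: frac_le add_nonneg_pos mult_left_mono)
  qed
  show "csum l w n * (1 / (real n + l * real (ones w)) - 1 / (real n + l * real (Suc (ones w)))) \<ge> 0"
    for n using * csum_nonneg[OF l] unfolding m_def by (intro mult_nonneg_nonneg) auto
  show "summable (\<lambda>n. csum l w n *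
           (1 / (real n + l * real (ones w)) - 1 / (real n + l * real (Suc (ones w)))))"
    unfolding m_def[symmetric]
  proof (rule summable_comparison_test)
    show "\<exists>N. \<forall>n\<ge>N. norm (csum l w n * (1 / (real n + l * real m) - 1 / (real n + l * real (Suc m))))
             \<le> K * (real (Suc n) powr (-3/2))"
    proof (intro exI allI impI)
      fix n
      let ?a = "real n + l * real m" and ?b = "real n + l * real (Suc m)"
      let ?c = "min 1 l * (real n + 1)"
      have c: "?c > 0" using l by simp
      have ab: "?a \<ge> ?c" "?b \<ge> ?c"
        using add_mult_ge_min[OF l, of m n] add_mult_ge_min[OF l, of "Suc m" n] m by auto
      have "1 / ?a - 1 / ?b = l / (?a * ?b)"
        using ab c by (simp add: field_simps)
      also have "\<dots> \<le> l / (?c * ?c)"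
        by (intro divide_left_mono mult_mono mult_pos_pos order.strict_trans2[OF c] ab)
           (use l c ab in linarith)+
      finally have "csum l w n * (1 / ?a - 1 / ?b) \<le>
          ((2 / min 1 l) ^ length w * sqrt (real n + 1)) * (l / (?c * ?c))"
        using csum_le[OF l w(1), of n] csum_nonneg[OF l, of w n] *[of n] by (intro mult_mono) auto
      also have "\<dots> = K * (sqrt (real n + 1) / (real n + 1)^2)"
        by (simp add: K_def power2_eq_square mult_ac)
      also have "sqrt (real n + 1) / (real n + 1)^2 = (real n + 1) powr (1/2 - 2)"
        by (subst powr_diff) (simp_all add: powr_half_sqrt)
      finally show "norm (csum l w n * (1 / ?a - 1 / ?b)) \<le> K * (real (Suc n) powr (-3/2))"
        using * csum_nonneg[OF l] by (simp add: abs_mult add_ac)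
    qed
    have "summable (\<lambda>n. real n powr (-3/2))" by (simp add: summable_real_powr_iff)
    thus "summable (\<lambda>n. K * (real (Suc n) powr (-3/2)))"
      by (intro summable_mult) (subst summable_Suc_iff)
  qed
qed

lemma diffint_conv_suminf:
  assumes l: "l > 0" and w: "regular_word w" "w \<noteq> []" and v: "0 < v" "v < 1"
  shows "diffint l w v = (\<Sum>n. csum l w n *
     (v powr (real n + l * real (ones w)) / (real n + l * real (ones w)) -
      v powr (real n + l * real (Suc (ones w))) / (real n + l * real (Suc (ones w)))))"
proof -
  have *: "(\<lambda>n. csum l w n * (v powr (real n + l * real (ones (a # w))) /
             (real n + l * real (ones (a # w))))) sums iterint l (a # w) v" for a
  proof -
    have "regular_word (a # w)" using w by (simp add: regular_word_Cons)
    hence "(\<lambda>n. coef l (a # w) n * v ^ n) sums (\<Sum>n. coef l (a # w) n * v ^ n)"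
      using summable_coef_power[OF l, of "a # w" v] v by (intro summable_sums) auto
    hence "(\<lambda>n. v powr (l * real (ones (a # w))) * (coef l (a # w) n * v ^ n)) sums iterint l (a # w) v"
      unfolding iterint_def by (rule sums_mult)
    thus ?thesis
      unfolding coef_Cons using v by (simp add: powr_add powr_realpow mult_ac)
  qed
  show ?thesis
    using sums_diff[OF *[of False] *[of True]]
    by (simp add: diffint_def sums_iff right_diff_distrib)
qed

text \<open>Tannery's theorem, with the terms of \<open>Dint\<close> itself as majorants.\<close>

lemma diffint_tendsto_Dint:
  assumes l: "l > 0" and w: "regular_word w" "w \<noteq> []"
  shows "(diffint l w \<longlongrightarrow> Dint l w) (at_left 1)"
proof -
  define m where "m = ones w"
  have m: "m \<ge> 1" using ones_pos[OF w] by (simp add: m_def)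
  let ?a = "\<lambda>n. real n + l * real m" and ?b = "\<lambda>n. real n + l * real (Suc m)"
  let ?t = "\<lambda>n v. csum l w n * (v powr ?a n / ?a n - v powr ?b n / ?b n)"
  let ?T = "\<lambda>n. csum l w n * (1 / ?a n - 1 / ?b n)"
  have ab: "0 < ?a n" "?a n \<le> ?b n" for n
    using l m by (auto intro!: add_nonneg_pos mult_left_mono)
  have "eventually (\<lambda>v. summable (\<lambda>k. norm (?t k v))) (at_left 1) \<and> summable (\<lambda>n. norm (?T n)) \<and>
          ((\<lambda>v. suminf (\<lambda>k. ?t k v)) \<longlongrightarrow> suminf ?T) (at_left 1)"
  proof (rule tannerys_theorem)
    fix n
    have "((\<lambda>v. ?t n v) \<longlongrightarrow> csum l w n * (1 powr ?a n / ?a n - 1 powr ?b n / ?b n)) (at_left 1)"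
      using ab[of n] by (intro tendsto_intros) auto
    thus "((\<lambda>v. ?t n v) \<longlongrightarrow> ?T n) (at_left 1)" by simp
  next
    have ev: "\<forall>\<^sub>F v in at_left (1::real). 0 < v \<and> v < 1"
      by (rule eventually_at_leftI[of 0]) auto
    show "\<forall>\<^sub>F (k, v) in sequentially \<times>\<^sub>F at_left 1. norm (?t k v) \<le> ?T k"
    proof (rule eventually_mono[OF eventually_prodI[OF eventually_True ev]])
      fix kv :: "nat \<times> real"
      assume "True \<and> 0 < snd kv \<and> snd kv < 1"
      moreover obtain k v where "kv = (k, v)" by (cases kv)
      ultimately have v: "0 < v" "v < 1" and kv: "kv = (k, v)" by auto
      show "case kv of (k, v) \<Rightarrow> norm (?t k v) \<le> ?T k"
        unfolding kv prod.case real_norm_def abs_mult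
        using powr_divide_diff_bounds[OF ab(1,2)[of k] v] csum_nonneg[OF l, of w k]
        by (intro mult_mono) (auto simp del: of_nat_Suc)
    qed
  next
    show "summable ?T" using Dint_terms(2)[OF l w] unfolding m_def .
  qed auto
  hence "((\<lambda>v. suminf (\<lambda>k. ?t k v)) \<longlongrightarrow> Dint l w) (at_left 1)"
    unfolding Dint_def m_def by blast
  moreover have "\<forall>\<^sub>F v in at_left 1. suminf (\<lambda>k. ?t k v) = diffint l w v"
    by (rule eventually_at_leftI[of 0]) (auto simp: diffint_conv_suminf[OF l w] m_def)
  ultimately show ?thesis by (simp add: tendsto_cong)
qed

lemma Dint_shuffle:
  assumes l: "l > 0" and u: "regular_word u" "u \<noteq> []" and w: "regular_word w" "w \<noteq> []"
  shows "Dint l u * Dint l w =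
           (\<Sum>x\<leftarrow>shuffle_list u (False # w). Dint l x) -
           (\<Sum>x\<leftarrow>shuffle_list u (True # w). Dint l x) +
           ((\<Sum>x\<leftarrow>shuffle_list (False # u) w. Dint l x) -
            (\<Sum>x\<leftarrow>shuffle_list (True # u) w. Dint l x))" (is "_ = ?R")
proof (rule tendsto_unique)
  have uw: "regular_word (a # u)" "regular_word (a # w)" for a
    using u w by (simp_all add: regular_word_Cons)
  have *: "((\<lambda>v. \<Sum>x\<leftarrow>shuffle_list a b. diffint l x v) \<longlongrightarrow> (\<Sum>x\<leftarrow>shuffle_list a b. Dint l x)) (at_left 1)"
    if "regular_word a" "regular_word b" "a \<noteq> []" for a b
    by (rule tendsto_sum_list)
       (use diffint_tendsto_Dint[OF l] regular_shuffle_list_nonempty[OF that(1,2)] that(3) in blast)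
  show "((\<lambda>v. diffint l u v * diffint l w v) \<longlongrightarrow> Dint l u * Dint l w) (at_left 1)"
    by (intro tendsto_mult diffint_tendsto_Dint l u w)
  have "((\<lambda>v. (\<Sum>x\<leftarrow>shuffle_list u (False # w). diffint l x v) -
           (\<Sum>x\<leftarrow>shuffle_list u (True # w). diffint l x v) +
           ((\<Sum>x\<leftarrow>shuffle_list (False # u) w. diffint l x v) -
            (\<Sum>x\<leftarrow>shuffle_list (True # u) w. diffint l x v))) \<longlongrightarrow> ?R) (at_left 1)"
    by (intro tendsto_add tendsto_diff * u uw w) auto
  moreover have "\<forall>\<^sub>F v in at_left 1. diffint l u v * diffint l w v =
       (\<Sum>x\<leftarrow>shuffle_list u (False # w). diffint l x v) -
           (\<Sum>x\<leftarrow>shuffle_list u (True # w). diffint l x v) +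
           ((\<Sum>x\<leftarrow>shuffle_list (False # u) w. diffint l x v) -
            (\<Sum>x\<leftarrow>shuffle_list (True # u) w. diffint l x v))"
    by (rule eventually_at_leftI[of 0]) (use diffint_shuffle[OF l u w] in auto)
  ultimately show "((\<lambda>v. diffint l u v * diffint l w v) \<longlongrightarrow> ?R) (at_left 1)"
    by (simp add: tendsto_cong)
qed auto

section \<open>The ring generated by the limit values\<close>

text \<open>Integer coefficients are enough because the recursion for the cumulants never divides.
  The definition yields an additive group; products are the content of
  \<open>Dring_mult\<close>.\<close>

definition Dring :: "real \<Rightarrow> real set" where
  "Dring l = group_closure (insert 1 {Dint l w | w. regular_word w \<and> w \<noteq> []})"

lemma Dring_1: "1 \<in> Dring l"
  and Dring_0: "0 \<in> Dring l"
  and Dring_Dint: "regular_word w \<Longrightarrow> w \<noteq> [] \<Longrightarrow> Dint l w \<in> Dring l"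
  and Dring_diff: "x \<in> Dring l \<Longrightarrow> y \<in> Dring l \<Longrightarrow> x - y \<in> Dring l"
  and Dring_add: "x \<in> Dring l \<Longrightarrow> y \<in> Dring l \<Longrightarrow> x + y \<in> Dring l"
  by (auto simp: Dring_def intro: group_closure.intros group_closure_add)

lemma Dring_sum: "(\<And>x. x \<in> A \<Longrightarrow> f x \<in> Dring l) \<Longrightarrow> (\<Sum>x\<in>A. f x) \<in> Dring l"
  by (induction A rule: infinite_finite_induct) (auto intro: Dring_add Dring_0)

lemma Dring_sum_list: "(\<And>x. x \<in> set xs \<Longrightarrow> f x \<in> Dring l) \<Longrightarrow> (\<Sum>x\<leftarrow>xs. f x) \<in> Dring l"
  by (induction xs) (auto intro: Dring_add Dring_0)

lemma Dring_of_nat: "real n \<in> Dring l"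
  by (induction n) (auto intro: Dring_add Dring_0 Dring_1)

text \<open>By bilinearity only products of two generators matter, and \<open>Dint_shuffle\<close>
  turns these into integer combinations of generators.\<close>

lemma Dring_mult:
  assumes l: "l > 0" and x: "x \<in> Dring l" and y: "y \<in> Dring l"
  shows "x * y \<in> Dring l"
proof -
  let ?G = "{Dint l w | w. regular_word w \<and> w \<noteq> []}"
  have gen: "Dint l u * Dint l w \<in> Dring l"
    if u: "regular_word u" "u \<noteq> []" and w: "regular_word w" "w \<noteq> []" for u w
  proof -
    have uw: "regular_word (a # u)" "regular_word (a # w)" for a
      using u w by (simp_all add: regular_word_Cons)
    have "(\<Sum>x\<leftarrow>shuffle_list a b. Dint l x) \<in> Dring l"
      if "regular_word a" "regular_word b" "a \<noteq> []" for a b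
      by (rule Dring_sum_list)
         (use Dring_Dint regular_shuffle_list_nonempty[OF that(1,2)] that(3) in blast)
    thus ?thesis
      unfolding Dint_shuffle[OF l u w] using u w uw by (intro Dring_add Dring_diff) auto
  qed
  have *: "Dint l u * y \<in> Dring l" if u: "regular_word u" "u \<noteq> []" for u
    using y unfolding Dring_def
  proof (induction rule: group_closure.induct)
    case (base s)
    then consider "s = 0" | "s = 1" | w where "s = Dint l w" "regular_word w" "w \<noteq> []" by auto
    thus ?case
      using gen[OF u] Dring_Dint[OF u] by cases (auto simp flip: Dring_def simp: Dring_0)
  next
    case (diff s t)
    thus ?case by (auto simp: right_diff_distrib simp flip: Dring_def intro: Dring_diff)
  qed
  show ?thesis
    using x unfolding Dring_def
  proof (induction rule: group_closure.induct)
    case (base s)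
    then consider "s = 0" | "s = 1" | w where "s = Dint l w" "regular_word w" "w \<noteq> []" by auto
    thus ?case
      using * y by cases (auto simp flip: Dring_def simp: Dring_0)
  next
    case (diff s t)
    thus ?case by (auto simp: left_diff_distrib simp flip: Dring_def intro: Dring_diff)
  qed
qed

section \<open>Comparison with the multiple series\<close>

text \<open>The shifts \<open>m\<^sub>1, m\<^sub>2, \<dots>\<close> of the series: \<open>m\<^sub>i\<close> counts the letters \<open>True\<close> among the innermost \<open>i\<close>.\<close>

fun weights :: "bool list \<Rightarrow> nat list" where
  "weights [] = []"
| "weights (a # w) = weights w @ [ones (a # w)]"

lemma length_weights [simp]: "length (weights w) = length w"
  by (induction w) auto

lemma weights_pos: "regular_word w \<Longrightarrow> m \<in> set (weights w) \<Longrightarrow> m \<ge> 1"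
proof (induction w)
  case (Cons a w)
  have "ones (a # w) \<ge> 1" using ones_pos[OF Cons.prems(1)] by simp
  thus ?case using Cons by (auto simp: regular_word_Cons)
qed simp

section \<open>Sums over chains of indices\<close>

definition chains_le :: "nat \<Rightarrow> nat \<Rightarrow> nat list set" where
  "chains_le r n = {ns \<in> index_chains r. \<forall>x\<in>set ns. x \<le> n}"

lemma finite_chains_le: "finite (chains_le r n)"
  by (rule finite_subset[OF _ finite_lists_length_eq[of "{..n}" r]])
     (auto simp: chains_le_def index_chains_def)

text \<open>Splitting off the largest index turns the multiple sum into a sum over \<open>m\<close>
  of finite inner sums.\<close>

lemma bij_betw_chains_snoc:
  "bij_betw (\<lambda>(m, ns). ns @ [m]) (SIGMA m:UNIV. chains_le r m) (index_chains (Suc r))"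
proof (rule bij_betwI[where g = "\<lambda>ns. (last ns, butlast ns)"])
  show "(\<lambda>ns. (last ns, butlast ns)) \<in> index_chains (Suc r) \<rightarrow> (SIGMA m:UNIV. chains_le r m)"
  proof
    fix ns assume "ns \<in> index_chains (Suc r)"
    moreover then obtain xs x where "ns = xs @ [x]"
      by (cases ns rule: rev_cases) (auto simp: index_chains_def)
    ultimately show "(last ns, butlast ns) \<in> (SIGMA m:UNIV. chains_le r m)"
      by (auto simp: index_chains_def chains_le_def sorted_append)
  qed
  fix ns assume "ns \<in> index_chains (Suc r)"
  thus "(\<lambda>(m, ns). ns @ [m]) (last ns, butlast ns) = ns"
    by (cases ns rule: rev_cases) (auto simp: index_chains_def)
qed (auto simp: index_chains_def chains_le_def sorted_append)

lemma bij_betw_chains_le_snoc: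
  "bij_betw (\<lambda>(m, ns). ns @ [m]) (SIGMA m:{..n}. chains_le r m) (chains_le (Suc r) n)"
proof -
  have "bij_betw (\<lambda>(m, ns). ns @ [m]) (SIGMA m:{..n}. chains_le r m)
          ((\<lambda>(m, ns). ns @ [m]) ` (SIGMA m:{..n}. chains_le r m))"
    by (rule bij_betw_subset[OF bij_betw_chains_snoc[of r]]) auto
  also have "(\<lambda>(m, ns). ns @ [m]) ` (SIGMA m:{..n}. chains_le r m) = chains_le (Suc r) n"
  proof (intro equalityI subsetI)
    fix ns assume ns: "ns \<in> chains_le (Suc r) n"
    then obtain xs x where "ns = xs @ [x]"
      by (cases ns rule: rev_cases) (auto simp: index_chains_def chains_le_def)
    thus "ns \<in> (\<lambda>(m, ns). ns @ [m]) ` (SIGMA m:{..n}. chains_le r m)"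
      using ns by (auto simp: chains_le_def index_chains_def sorted_append intro!: image_eqI[of _ _ "(x, xs)"])
  qed (auto simp: chains_le_def index_chains_def sorted_append intro: order.trans)
  finally show ?thesis .
qed

definition chain_term :: "real \<Rightarrow> nat list \<Rightarrow> nat list \<Rightarrow> real" where
  "chain_term l ms ns = (\<Prod>i<length ms. 1 / (real (ns ! i) + l * real (ms ! i)))"

lemma chain_term_snoc:
  "length ns = length ms \<Longrightarrow>
     chain_term l (ms @ [m]) (ns @ [n]) = chain_term l ms ns / (real n + l * real m)"
  by (simp add: chain_term_def nth_append)

text \<open>Each letter adds one outer summation index, so the innermost letter belongs to the
  smallest index of the chain.\<close>

lemma csum_conv_chains: "csum l w n = (\<Sum>ns\<in>chains_le (length w) n. chain_term l (weights w) ns)"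
proof (induction w arbitrary: n)
  case Nil
  have "chains_le 0 n = {[]}" by (auto simp: chains_le_def index_chains_def)
  thus ?case by (simp add: csum_def chain_term_def)
next
  case (Cons a w)
  have "csum l (a # w) n = (\<Sum>m\<le>n. csum l w m / (real m + l * real (ones (a # w))))"
    unfolding csum_def[of l "a # w"] coef_Cons ..
  also have "\<dots> = (\<Sum>m\<le>n. \<Sum>ns\<in>chains_le (length w) m. chain_term l (weights (a # w)) (ns @ [m]))"
    by (intro sum.cong refl)
       (auto simp: Cons chain_term_snoc chains_le_def index_chains_def sum_divide_distrib)
  also have "\<dots> = (\<Sum>(m, ns)\<in>(SIGMA m:{..n}. chains_le (length w) m). chain_term l (weights (a # w)) (ns @ [m]))"
    by (rule sum.Sigma) (auto intro: finite_chains_le)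
  also have "\<dots> = (\<Sum>ns\<in>chains_le (length (a # w)) n. chain_term l (weights (a # w)) ns)"
    using sum.reindex_bij_betw[OF bij_betw_chains_le_snoc, of "chain_term l (weights (a # w))" n "length w"]
    by (simp add: case_prod_unfold)
  finally show ?case .
qed

text \<open>Partial fractions: for \<open>l = 1 / \<mu>\<close> the bracket in \<open>Dint\<close>
  equals \<open>\<mu> / ((n \<mu> + m) (n \<mu> + m + 1))\<close>, and each inner factor
  \<open>1 / (n + l m)\<close> supplies one more \<open>\<mu>\<close>. The shifts \<open>m\<close>
  and \<open>m + 1\<close> differ by 1, so the prefactor of \<open>D_mu\<close> is 1.\<close>

lemma Dint_eq_D_mu:
  assumes mu: "\<mu> > 0" and w: "regular_word w" "w \<noteq> []"
  defines "ms \<equiv> map of_nat (weights w) :: rat list" and "m \<equiv> (of_nat (ones w) :: rat)"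
  shows "Dint (1 / \<mu>) w = D_mu \<mu> (replicate (Suc (length w)) 1) (ms @ [m]) (ms @ [m + 1])"
proof -
  define r where "r = length w"
  define l where "l = 1 / \<mu>"
  have l: "l > 0" using mu by (simp add: l_def)
  let ?c = "\<lambda>n. 1 / (real n + l * real (ones w)) - 1 / (real n + l * real (Suc (ones w)))"
  let ?f = "\<lambda>(n, ns). chain_term l (weights w) ns * ?c n"
  have m1: "ones w \<ge> 1" using ones_pos[OF w] .
  have cpos: "?c n \<ge> 0" for n
  proof -
    have "0 < l * real (ones w)" using l m1 by simp
    thus ?thesis using l by (auto intro!: frac_le add_nonneg_pos mult_left_mono)
  qed
  have inner: "((\<lambda>ns. ?f (n, ns)) has_sum (csum l w n * ?c n)) (chains_le r n)" for n
    using has_sum_finite[OF finite_chains_le, of "\<lambda>ns. ?f (n, ns)" r n]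
    by (simp add: csum_conv_chains r_def sum_distrib_right)
  have outer: "((\<lambda>n. csum l w n * ?c n) has_sum Dint l w) UNIV"
    unfolding Dint_def using Dint_terms[OF l w]
    by (intro sums_nonneg_imp_has_sum summable_sums) auto
  \<comment> \<open>All terms are nonnegative, so the iterated sum, finite inside and convergent
    outside, is an unordered sum over all chains.\<close>
  have "?f summable_on (SIGMA n:UNIV. chains_le r n)"
  proof (rule summable_on_SigmaI[OF inner])
    show "(\<lambda>n. csum l w n * ?c n) summable_on UNIV"
      using outer by (rule has_sum_imp_summable)
    fix n ns
    show "0 \<le> ?f (n, ns)"
      using cpos[of n] l by (auto simp: chain_term_def intro!: mult_nonneg_nonneg prod_nonneg)
  qed
  hence "(?f has_sum Dint l w) (SIGMA n:UNIV. chains_le r n)"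
    by (intro has_sum_SigmaI[OF inner outer])
  also have "?this \<longleftrightarrow> ((\<lambda>(n, ns). \<mu> ^ Suc r /
        ((\<Prod>i<r. (real ((ns @ [n]) ! i) * \<mu> + of_rat ((ms @ [m]) ! i)) ^ (replicate (Suc r) 1 ! i)) *
         (real (last (ns @ [n])) * \<mu> + of_rat (last (ms @ [m]))) *
         (real (last (ns @ [n])) * \<mu> + of_rat (last (ms @ [m + 1])))))
       has_sum Dint l w) (SIGMA n:UNIV. chains_le r n)"
  proof (intro has_sum_cong, clarify)
    fix n ns assume ns: "ns \<in> chains_le r n"
    hence len: "length ns = r" by (simp add: chains_le_def index_chains_def)
    have "(\<Prod>i<r. (real ((ns @ [n]) ! i) * \<mu> + of_rat ((ms @ [m]) ! i)) ^ (replicate (Suc r) 1 ! i)) =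
          (\<Prod>i<r. \<mu> * (real (ns ! i) + l * real (weights w ! i)))"
    proof (intro prod.cong refl)
      fix i assume "i \<in> {..<r}"
      thus "(real ((ns @ [n]) ! i) * \<mu> + of_rat ((ms @ [m]) ! i)) ^ (replicate (Suc r) 1 ! i) =
            \<mu> * (real (ns ! i) + l * real (weights w ! i))"
        using len mu by (simp add: nth_append ms_def r_def l_def nth_replicate algebra_simps del: replicate_Suc)
    qed
    also have "\<dots> = \<mu> ^ r * (\<Prod>i<r. real (ns ! i) + l * real (weights w ! i))"
      by (simp add: prod.distrib)
    finally have P: "(\<Prod>i<r. (real ((ns @ [n]) ! i) * \<mu> + of_rat ((ms @ [m]) ! i)) ^ (replicate (Suc r) 1 ! i)) =
        \<mu> ^ r * (\<Prod>i<r. real (ns ! i) + l * real (weights w ! i))" .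
    have "real n + l * real (ones w) > 0"
      using l m1 by (intro add_nonneg_pos) auto
    moreover have "real n + l * real (Suc (ones w)) > 0"
      using l by (intro add_nonneg_pos) auto
    ultimately have "?c n = l / ((real n + l * real (ones w)) * (real n + l * real (Suc (ones w))))"
      by (simp add: field_simps)
    also have "\<dots> = \<mu> / ((real n * \<mu> + real (ones w)) * (real n * \<mu> + real (Suc (ones w))))"
      using mu unfolding l_def by (simp add: field_simps)
    finally have c: "?c n = \<mu> / ((real n * \<mu> + real (ones w)) * (real n * \<mu> + real (Suc (ones w))))" .
    have ct: "chain_term l (weights w) ns = 1 / (\<Prod>i<r. real (ns ! i) + l * real (weights w ! i))"
      by (simp add: chain_term_def r_def prod_dividef)
    have m': "of_rat m = real (ones w)" "of_rat (m + 1) = real (Suc (ones w))"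
      by (simp_all add: m_def of_rat_add)
    show "chain_term l (weights w) ns * ?c n = \<mu> ^ Suc r /
        ((\<Prod>i<r. (real ((ns @ [n]) ! i) * \<mu> + of_rat ((ms @ [m]) ! i)) ^ (replicate (Suc r) 1 ! i)) *
         (real (last (ns @ [n])) * \<mu> + of_rat (last (ms @ [m]))) *
         (real (last (ns @ [n])) * \<mu> + of_rat (last (ms @ [m + 1]))))"
      unfolding P c ct last_snoc m' using mu by (simp add: divide_simps)
  qed
  also have "\<dots> \<longleftrightarrow> ((\<lambda>ns. \<mu> ^ Suc r /
        ((\<Prod>i<r. (real (ns ! i) * \<mu> + of_rat ((ms @ [m]) ! i)) ^ (replicate (Suc r) 1 ! i)) *
         (real (last ns) * \<mu> + of_rat (last (ms @ [m]))) *
         (real (last ns) * \<mu> + of_rat (last (ms @ [m + 1])))))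
       has_sum Dint l w) (index_chains (Suc r))"
    by (subst has_sum_reindex_bij_betw[OF bij_betw_chains_snoc, symmetric]) (simp add: case_prod_unfold)
  finally show ?thesis
    unfolding D_mu_def r_def[symmetric] l_def by (simp add: infsumI del: replicate_Suc)
qed

section \<open>The coefficient ring and the span\<close>

lemma rat_adjoin_const: "of_rat q \<in> rat_adjoin \<mu>"
  unfolding rat_adjoin_def by (rule range_eqI[of _ _ "[:q:]"]) (simp add: map_poly_pCons)

lemma rat_adjoin_gen: "\<mu> \<in> rat_adjoin \<mu>"
  unfolding rat_adjoin_def by (rule range_eqI[of _ _ "[:0, 1:]"]) (simp add: map_poly_pCons)

lemma map_poly_of_rat_add:
  "map_poly (of_rat :: rat \<Rightarrow> real) (p + q) = map_poly of_rat p + map_poly of_rat q"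
  by (rule poly_eqI) (simp add: coeff_map_poly of_rat_add)

lemma map_poly_of_rat_mult:
  "map_poly (of_rat :: rat \<Rightarrow> real) (p * q) = map_poly of_rat p * map_poly of_rat q"
  by (rule poly_eqI) (simp add: coeff_map_poly coeff_mult of_rat_sum of_rat_mult)

lemma rat_adjoin_add: "x \<in> rat_adjoin \<mu> \<Longrightarrow> y \<in> rat_adjoin \<mu> \<Longrightarrow> x + y \<in> rat_adjoin \<mu>"
  unfolding rat_adjoin_def by (auto simp flip: poly_add map_poly_of_rat_add)

lemma rat_adjoin_mult: "x \<in> rat_adjoin \<mu> \<Longrightarrow> y \<in> rat_adjoin \<mu> \<Longrightarrow> x * y \<in> rat_adjoin \<mu>"
  unfolding rat_adjoin_def by (auto simp flip: poly_mult map_poly_of_rat_mult)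

lemma rat_adjoin_power: "x \<in> rat_adjoin \<mu> \<Longrightarrow> x ^ n \<in> rat_adjoin \<mu>"
  using rat_adjoin_const[of 1] by (induction n) (auto intro: rat_adjoin_mult)

lemma Z_space_gen: "x \<in> Z_generators \<mu> \<Longrightarrow> x \<in> Z_space \<mu>"
  unfolding Z_space_def using rat_adjoin_const[of 1 \<mu>]
  by (intro CollectI exI[of _ "{x}"] exI[of _ "\<lambda>_. 1"]) auto

lemma Z_space_add:
  assumes "x \<in> Z_space \<mu>" "y \<in> Z_space \<mu>"
  shows "x + y \<in> Z_space \<mu>"
proof -
  obtain S c where S: "finite S" "S \<subseteq> Z_generators \<mu>" "\<forall>x\<in>S. c x \<in> rat_adjoin \<mu>" "x = (\<Sum>s\<in>S. c s * s)"
    using assms(1) unfolding Z_space_def by auto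
  obtain T d where T: "finite T" "T \<subseteq> Z_generators \<mu>" "\<forall>x\<in>T. d x \<in> rat_adjoin \<mu>" "y = (\<Sum>s\<in>T. d s * s)"
    using assms(2) unfolding Z_space_def by auto
  \<comment> \<open>A generator lying in both supports receives the sum of its two
    coefficients.\<close>
  define e where "e s = (if s \<in> S then c s else 0) + (if s \<in> T then d s else 0)" for s
  have "x = (\<Sum>s\<in>S \<union> T. (if s \<in> S then c s else 0) * s)"
    unfolding S by (rule sum.mono_neutral_cong_left) (use S T in auto)
  moreover have "y = (\<Sum>s\<in>S \<union> T. (if s \<in> T then d s else 0) * s)"
    unfolding T by (rule sum.mono_neutral_cong_left) (use S T in auto)
  ultimately have "x + y = (\<Sum>s\<in>S \<union> T. e s * s)"
    by (simp add: e_def algebra_simps sum.distrib)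
  moreover have "\<forall>s\<in>S \<union> T. e s \<in> rat_adjoin \<mu>"
    unfolding e_def using S T rat_adjoin_const[of 0 \<mu>] by (auto intro: rat_adjoin_add)
  ultimately show ?thesis
    unfolding Z_space_def using S T by (intro CollectI exI[of _ "S \<union> T"] exI[of _ e]) auto
qed

lemma Z_space_scale:
  assumes "c \<in> rat_adjoin \<mu>" "x \<in> Z_space \<mu>"
  shows "c * x \<in> Z_space \<mu>"
proof -
  obtain S d where S: "finite S" "S \<subseteq> Z_generators \<mu>" "\<forall>x\<in>S. d x \<in> rat_adjoin \<mu>" "x = (\<Sum>s\<in>S. d s * s)"
    using assms(2) unfolding Z_space_def by auto
  have "c * x = (\<Sum>s\<in>S. (c * d s) * s)" by (simp add: S sum_distrib_left mult_ac)
  thus ?thesis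
    unfolding Z_space_def using S assms(1) by (auto intro!: exI[of _ S] exI[of _ "\<lambda>s. c * d s"] rat_adjoin_mult)
qed

lemma Z_space_diff: "x \<in> Z_space \<mu> \<Longrightarrow> y \<in> Z_space \<mu> \<Longrightarrow> x - y \<in> Z_space \<mu>"
  using Z_space_add[of x \<mu> "of_rat (-1) * y"] Z_space_scale[OF rat_adjoin_const[of "-1"], of y \<mu>] by simp

text \<open>\<open>Dint_eq_D_mu\<close> exhibits each generator as the value of a triple with all
  exponents 1; regularity of the word makes every shift positive.\<close>

lemma Dring_subset_Z_space:
  assumes "\<mu> > 0" "x \<in> Dring (1 / \<mu>)"
  shows "x \<in> Z_space \<mu>"
  using assms(2) unfolding Dring_def
proof (induction rule: group_closure.induct)
  case (base s)
  have one: "1 \<in> Z_space \<mu>" by (rule Z_space_gen) (simp add: Z_generators_def)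
  consider "s = 0" | "s = 1" | w where "s = Dint (1 / \<mu>) w" "regular_word w" "w \<noteq> []"
    using base by auto
  thus ?case
  proof cases
    case 3
    let ?ms = "map of_nat (weights w) :: rat list"
    have "special_triple (replicate (Suc (length w)) 1) (?ms @ [of_nat (ones w)]) (?ms @ [of_nat (ones w) + 1])"
      unfolding special_triple_def using weights_pos[OF 3(2)] ones_pos[OF 3(2,3)]
      by (auto simp: last_replicate Suc_le_eq simp del: replicate_Suc)
    thus ?thesis
      unfolding 3(1) Dint_eq_D_mu[OF assms(1) 3(2,3)] Z_generators_def
      by (intro Z_space_gen) (unfold Z_generators_def, blast)
  qed (use one Z_space_diff[OF one one] in auto)
qed (rule Z_space_diff)

lemma shifted_zeta_in_Z_space:
  assumes "\<mu> > 0" "k \<ge> 2"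
  shows "(\<Sum>n. 1 / (real n + 1 / \<mu>) ^ k) \<in> Z_space \<mu>"
proof -
  have "admissible [k] [1]" using assms by (simp add: admissible_def)
  hence gen: "zeta_mu \<mu> [k] [1] \<in> Z_space \<mu>"
    by (intro Z_space_gen) (unfold Z_generators_def, blast)
  have bij: "bij_betw (\<lambda>n. [n]) UNIV (index_chains 1)"
    by (rule bij_betwI[where g = hd]) (auto simp: index_chains_def length_Suc_conv)
  have sm: "summable (\<lambda>n. 1 / (real n + 1 / \<mu>) ^ k)"
    using Polygamma_converges'[of "1 / \<mu>" k] assms by (simp add: inverse_eq_divide add_ac)
  have *: "\<mu> / (real n * \<mu> + 1) ^ k = \<mu> / \<mu> ^ k * (1 / (real n + 1 / \<mu>) ^ k)" for n
  proof -
    have "real n * \<mu> + 1 = \<mu> * (real n + 1 / \<mu>)" using assms by (simp add: algebra_simps)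
    thus ?thesis by (simp add: power_mult_distrib)
  qed
  have "(\<lambda>n. \<mu> / (real n * \<mu> + 1) ^ k) sums (\<mu> / \<mu> ^ k * (\<Sum>n. 1 / (real n + 1 / \<mu>) ^ k))"
    unfolding * by (intro sums_mult summable_sums sm)
  hence "((\<lambda>n. \<mu> / (real n * \<mu> + 1) ^ k) has_sum (\<mu> / \<mu> ^ k * (\<Sum>n. 1 / (real n + 1 / \<mu>) ^ k))) UNIV"
    using assms by (intro sums_nonneg_imp_has_sum) auto
  hence "(\<Sum>\<^sub>\<infinity>n. \<mu> / (real n * \<mu> + 1) ^ k) = \<mu> / \<mu> ^ k * (\<Sum>n. 1 / (real n + 1 / \<mu>) ^ k)"
    by (rule infsumI)
  moreover have "zeta_mu \<mu> [k] [1] = (\<Sum>\<^sub>\<infinity>n. \<mu> / (real n * \<mu> + 1) ^ k)"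
    unfolding zeta_mu_def
    using infsum_reindex_bij_betw[OF bij, of "\<lambda>ns. \<mu> / (real (ns ! 0) * \<mu> + 1) ^ k"] by simp
  \<comment> \<open>The scaling factor is a power of \<open>\<mu>\<close> with nonnegative exponent,
    so it lies in the coefficient ring.\<close>
  ultimately have "(\<Sum>n. 1 / (real n + 1 / \<mu>) ^ k) = \<mu> ^ (k - 1) * zeta_mu \<mu> [k] [1]"
    using assms by (simp add: power_diff field_simps)
  thus ?thesis using Z_space_scale[OF rat_adjoin_power[OF rat_adjoin_gen] gen] by simp
qed

section \<open>Moments of the logarithmic odds\<close>

text \<open>\<open>X\<close> is \<open>lgt V\<close>, and \<open>- lgt\<close> is the antiderivative
  of the form for \<open>False\<close> that vanishes at \<open>1/2\<close>.\<close>

definition lgt :: "real \<Rightarrow> real" where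
  "lgt v = ln (1 - v) - ln v"

lemma has_real_derivative_lgt:
  assumes "0 < v" "v < 1"
  shows "(lgt has_real_derivative - (1 / (v * (1 - v)))) (at v)"
proof -
  have "((\<lambda>v. ln (1 - v) - ln v) has_real_derivative (- 1 / (1 - v) - 1 / v)) (at v)"
    using assms by (auto intro!: derivative_eq_intros)
  also have "(- 1 / (1 - v) - 1 / v) = - (1 / (v * (1 - v)))"
    using assms by (simp add: field_simps)
  finally show ?thesis unfolding lgt_def .
qed

text \<open>\<open>exp (z * lgt v)\<close> is \<open>v powr (- z) * (1 - v) powr z\<close>, so this
  is a Beta integral; \<open>z < l\<close> is convergence at 0 and \<open>-1 < z\<close> convergence
  at 1.\<close>

lemma has_integral_exp_lgt:
  assumes "l > 0" "-1 < z" "z < l"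
  shows "((\<lambda>v. l * v powr (l - 1) * exp (z * lgt v)) has_integral l * Beta (l - z) (1 + z)) {0<..<1}"
proof -
  have "((\<lambda>v. l * (v powr (l - z - 1) * (1 - v) powr (1 + z - 1))) has_integral l * Beta (l - z) (1 + z)) {0<..<1}"
    using has_integral_mult_right[OF has_integral_Beta_real[of "l - z" "1 + z"], of l] assms
    by (simp add: has_integral_Icc_iff_Ioo)
  also have "?this \<longleftrightarrow> ?thesis"
  proof (rule has_integral_cong)
    fix v :: real assume "v \<in> {0<..<1}"
    thus "l * (v powr (l - z - 1) * (1 - v) powr (1 + z - 1)) = l * v powr (l - 1) * exp (z * lgt v)"
      by (simp add: lgt_def powr_def right_diff_distrib left_diff_distrib exp_diff exp_add mult_ac)
  qed
  finally show ?thesis .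
qed

lemma sum_power_le_exp:
  fixes x :: real
  assumes "x \<ge> 0"
  shows "(\<Sum>i<n. x ^ i / fact i) \<le> exp x"
proof -
  have "(\<lambda>i. x ^ i / fact i) sums exp x"
    using exp_converges[of x] by (simp add: scaleR_conv_of_real field_simps)
  thus ?thesis
    using sum_le_suminf[of "\<lambda>i. x ^ i / fact i" "{..<n}"] assms by (simp add: sums_iff)
qed

lemma power_le_exp:
  fixes x :: real
  assumes "x \<ge> 0"
  shows "x ^ n / fact n \<le> exp x"
proof -
  have "x ^ n / fact n \<le> (\<Sum>i<Suc n. x ^ i / fact i)"
    by (rule member_le_sum) (use assms in auto)
  thus ?thesis using sum_power_le_exp[OF assms, of "Suc n"] by linarith
qed

lemma exp_abs_le: "exp (r * \<bar>x\<bar>) \<le> exp (r * x) + exp (- r * x)" for x r :: real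
  by (cases "x \<ge> 0") auto

text \<open>Through \<open>exp_abs_le\<close> this is the common majorant for the powers of
  \<open>lgt\<close> and for the partial sums of \<open>exp (z * lgt v)\<close>.\<close>

lemma integrable_exp_lgt:
  assumes "l > 0" "0 < r" "r < 1" "r < l"
  shows "(\<lambda>v. l * v powr (l - 1) * (exp (r * lgt v) + exp (- r * lgt v))) integrable_on {0<..<1}"
  unfolding distrib_left using assms
  by (intro integrable_add has_integral_integrable[OF has_integral_exp_lgt]) auto

text \<open>This is \<open>E [X^i; V \<le> v]\<close>, hence the full moment at
  \<open>v = 1\<close>.\<close>

definition lgt_moment :: "real \<Rightarrow> nat \<Rightarrow> real \<Rightarrow> real" where
  "lgt_moment l i v = integral {0..v} (\<lambda>s. l * s powr (l - 1) * lgt s ^ i)"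

lemma continuous_on_lgt_integrand:
  "continuous_on {0<..<1} (\<lambda>v. l * v powr (l - 1) * lgt v ^ i)"
  unfolding lgt_def by (intro continuous_intros) auto

lemma integrable_lgt_power:
  assumes l: "l > 0"
  shows "(\<lambda>v. l * v powr (l - 1) * lgt v ^ i) integrable_on {0<..<1}"
proof -
  \<comment> \<open>Half of \<open>min 1 l\<close> keeps both \<open>r\<close> and
    \<open>- r\<close> strictly between -1 and \<open>l\<close>.\<close>
  define r where "r = min 1 l / 2"
  have r: "0 < r" "r < 1" "r < l" using l by (auto simp: r_def min_def)
  show ?thesis
  proof (rule measurable_bounded_by_integrable_imp_integrable)
    show "(\<lambda>v. l * v powr (l - 1) * lgt v ^ i) \<in> borel_measurable (lebesgue_on {0<..<1})"
      by (intro continuous_imp_measurable_on_sets_lebesgue continuous_on_lgt_integrand) auto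
    show "(\<lambda>v. (fact i / r ^ i) * (l * v powr (l - 1) * (exp (r * lgt v) + exp (- r * lgt v)))) integrable_on {0<..<1}"
      by (intro integrable_on_mult_right integrable_exp_lgt l r)
    fix v :: real
    have "(r * \<bar>lgt v\<bar>) ^ i / fact i \<le> exp (r * lgt v) + exp (- r * lgt v)"
      using power_le_exp[of "r * \<bar>lgt v\<bar>" i] exp_abs_le[of r "lgt v"] r by simp
    hence "\<bar>lgt v\<bar> ^ i \<le> (fact i / r ^ i) * (exp (r * lgt v) + exp (- r * lgt v))"
      using r by (simp add: power_mult_distrib field_simps)
    hence "l * v powr (l - 1) * \<bar>lgt v\<bar> ^ i \<le>
           l * v powr (l - 1) * ((fact i / r ^ i) * (exp (r * lgt v) + exp (- r * lgt v)))"
      using l by (intro mult_left_mono) auto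
    thus "norm (l * v powr (l - 1) * lgt v ^ i) \<le>
            (fact i / r ^ i) * (l * v powr (l - 1) * (exp (r * lgt v) + exp (- r * lgt v)))"
      using l by (simp add: abs_mult power_abs mult_ac)
  qed auto
qed

lemma integrable_lgt_power_Icc:
  "l > 0 \<Longrightarrow> (\<lambda>v. l * v powr (l - 1) * lgt v ^ i) integrable_on {0..1}"
  using integrable_lgt_power by (simp add: integrable_on_Icc_iff_Ioo)

text \<open>Dominated convergence for the partial sums of the exponential series: since
  \<open>\<bar>z\<bar> < r\<close>, all of them are bounded by
  \<open>exp (r * \<bar>lgt v\<bar>)\<close>.\<close>

lemma lgt_moment_sums:
  assumes l: "l > 0" and z: "\<bar>z\<bar> < min 1 l / 2"
  shows "(\<lambda>i. lgt_moment l i 1 / fact i * z ^ i) sums (l * Beta (l - z) (1 + z))"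
proof -
  define r where "r = min 1 l / 2"
  have r: "0 < r" "r < 1" "r < l" "\<bar>z\<bar> < r" using l z by (auto simp: r_def min_def)
  define f where "f n v = (\<Sum>i<n. l * v powr (l - 1) * lgt v ^ i * (z ^ i / fact i))" for n :: nat and v :: real
  have mom: "((\<lambda>v. l * v powr (l - 1) * lgt v ^ i) has_integral lgt_moment l i 1) {0<..<1}" for i
    using integrable_integral[OF integrable_lgt_power_Icc[OF l, of i]]
    by (simp add: has_integral_Icc_iff_Ioo lgt_moment_def)
  have f: "(f n has_integral (\<Sum>i<n. lgt_moment l i 1 * (z ^ i / fact i))) {0<..<1}" for n
    unfolding f_def by (intro has_integral_sum has_integral_mult_left mom) auto
  let ?h = "\<lambda>v. l * v powr (l - 1) * (exp (r * lgt v) + exp (- r * lgt v))"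
  have "(\<lambda>n. integral {0<..<1} (f n)) \<longlonglongrightarrow> integral {0<..<1} (\<lambda>v. l * v powr (l - 1) * exp (z * lgt v))"
  proof (rule dominated_convergence(2))
    show "f n integrable_on {0<..<1}" for n using f by (rule has_integral_integrable)
    show "?h integrable_on {0<..<1}" by (rule integrable_exp_lgt) (use l r in auto)
  next
    fix n and v :: real
    have f': "f n v = l * v powr (l - 1) * (\<Sum>i<n. (z * lgt v) ^ i / fact i)"
      by (simp add: f_def sum_distrib_left power_mult_distrib mult_ac)
    have "\<bar>\<Sum>i<n. (z * lgt v) ^ i / fact i\<bar> \<le> (\<Sum>i<n. \<bar>z * lgt v\<bar> ^ i / fact i)"
      by (rule order.trans[OF sum_abs]) (simp add: power_abs)
    also have "\<dots> \<le> exp \<bar>z * lgt v\<bar>" by (rule sum_power_le_exp) simp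
    also have "\<dots> \<le> exp (r * \<bar>lgt v\<bar>)"
      using r by (simp add: abs_mult mult_right_mono)
    also have "\<dots> \<le> exp (r * lgt v) + exp (- r * lgt v)" by (rule exp_abs_le)
    finally show "norm (f n v) \<le> ?h v"
      unfolding f' real_norm_def abs_mult using l by (intro mult_mono) auto
  next
    fix v :: real
    have f': "f n v = l * v powr (l - 1) * (\<Sum>i<n. (z * lgt v) ^ i / fact i)" for n
      by (simp add: f_def sum_distrib_left power_mult_distrib mult_ac)
    show "(\<lambda>n. f n v) \<longlonglongrightarrow> l * v powr (l - 1) * exp (z * lgt v)"
      unfolding f' using exp_converges[of "z * lgt v"]
      by (intro tendsto_mult tendsto_const)
         (simp add: sums_def scaleR_conv_of_real divide_inverse mult_ac)
  qed
  also have "(\<lambda>n. integral {0<..<1} (f n)) = (\<lambda>n. \<Sum>i<n. lgt_moment l i 1 / fact i * z ^ i)"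
    using f by (auto simp: integral_unique)
  also have "integral {0<..<1} (\<lambda>v. l * v powr (l - 1) * exp (z * lgt v)) = l * Beta (l - z) (1 + z)"
    by (rule integral_unique, rule has_integral_exp_lgt) (use l r in auto)
  finally show ?thesis by (simp add: sums_def)
qed

lemma has_real_derivative_lgt_moment:
  assumes "l > 0" "0 < v" "v < 1"
  shows "(lgt_moment l i has_real_derivative l * v powr (l - 1) * lgt v ^ i) (at v)"
proof -
  have "isCont (\<lambda>v. l * v powr (l - 1) * lgt v ^ i) v"
    using continuous_on_lgt_integrand[of l i] assms
    by (intro continuous_on_interior[of "{0<..<1}"]) (auto simp: interior_open)
  hence "((\<lambda>v. integral {0..v} (\<lambda>s. l * s powr (l - 1) * lgt s ^ i)) has_vector_derivative
          l * v powr (l - 1) * lgt v ^ i) (at v within {0..1})"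
    using assms integrable_lgt_power_Icc[OF assms(1), of i]
      integral_has_vector_derivative_continuous_at[of "\<lambda>v. l * v powr (l - 1) * lgt v ^ i" 0 1 v "{}"]
    by (auto intro: continuous_at_imp_continuous_at_within)
  moreover have "at v within {0..1} = at v"
    using assms by (intro at_within_interior) auto
  ultimately show ?thesis
    by (simp add: has_real_derivative_iff_has_vector_derivative lgt_moment_def[abs_def])
qed

lemma continuous_on_lgt_moment: "l > 0 \<Longrightarrow> continuous_on {0..1} (lgt_moment l i)"
  unfolding lgt_moment_def[abs_def] by (intro indefinite_integral_continuous_1 integrable_lgt_power_Icc)

section \<open>Behaviour at the endpoints\<close>

lemma lgt_moment_at_0: "l > 0 \<Longrightarrow> (lgt_moment l i \<longlongrightarrow> 0) (at_right 0)"
  using continuous_on_lgt_moment[of l i] continuous_on_Icc_at_rightD[of 0 1 "lgt_moment l i"]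
  by (simp add: lgt_moment_def)

lemma lgt_moment_at_1: "l > 0 \<Longrightarrow> (lgt_moment l i \<longlongrightarrow> lgt_moment l i 1) (at_left 1)"
  using continuous_on_lgt_moment[of l i] continuous_on_Icc_at_leftD[of 0 1 "lgt_moment l i"]
  by simp

lemma lgt_antimono: "0 < s \<Longrightarrow> s \<le> v \<Longrightarrow> v < 1 \<Longrightarrow> lgt v \<le> lgt s"
  unfolding lgt_def by (intro diff_mono) auto

text \<open>Near 0 \<open>lgt\<close> is nonnegative and decreasing. So \<open>lgt v ^ j\<close> may
  be replaced by the larger \<open>lgt s ^ j\<close> under the integral, and the product is squeezed
  between 0 and the moment of order \<open>i + j\<close>.\<close>

lemma lgt_moment_times_power_at_0:
  assumes l: "l > 0"
  shows "((\<lambda>v. lgt_moment l i v * lgt v ^ j) \<longlongrightarrow> 0) (at_right 0)"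
proof (rule tendsto_sandwich[OF _ _ tendsto_const lgt_moment_at_0[OF l, of "i + j"]])
  have *: "0 \<le> lgt_moment l i v * lgt v ^ j \<and> lgt_moment l i v * lgt v ^ j \<le> lgt_moment l (i + j) v"
    if v: "0 < v" "v < 1/2" for v
  proof -
    \<comment> \<open>At the endpoint \<open>s = 0\<close> the default \<open>ln 0 = 0\<close> gives
      \<open>lgt 0 = 0\<close>; in the comparison below, \<open>0 powr (l - 1) = 0\<close> makes
      both sides vanish there.\<close>
    have pos: "0 \<le> lgt s" if "0 \<le> s" "s \<le> v" for s
      using that v by (cases "s = 0") (auto simp: lgt_def)
    have int: "(\<lambda>s. l * s powr (l - 1) * lgt s ^ i) integrable_on {0..v}" for i
      by (rule integrable_subinterval_real[OF integrable_lgt_power_Icc[OF l]]) (use v in auto)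
    have "lgt_moment l i v * lgt v ^ j = integral {0..v} (\<lambda>s. l * s powr (l - 1) * lgt s ^ i * lgt v ^ j)"
      unfolding lgt_moment_def by simp
    also have "\<dots> \<le> integral {0..v} (\<lambda>s. l * s powr (l - 1) * lgt s ^ (i + j))"
    proof (intro integral_le int integrable_on_mult_left)
      fix s assume s: "s \<in> {0..v}"
      show "l * s powr (l - 1) * lgt s ^ i * lgt v ^ j \<le> l * s powr (l - 1) * lgt s ^ (i + j)"
      proof (cases "s = 0")
        case False
        have "lgt v ^ j \<le> lgt s ^ j"
          using s v False pos[of v] by (intro power_mono lgt_antimono) auto
        thus ?thesis unfolding power_add mult.assoc[symmetric]
          using l s pos by (intro mult_left_mono) auto
      qed simp
    qed
    moreover have "0 \<le> lgt_moment l i v"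
      unfolding lgt_moment_def by (intro integral_nonneg int) (use l pos in auto)
    ultimately show ?thesis
      using pos[of v] v by (auto simp flip: lgt_moment_def intro!: mult_nonneg_nonneg)
  qed
  show "\<forall>\<^sub>F v in at_right 0. 0 \<le> lgt_moment l i v * lgt v ^ j"
    by (rule eventually_at_rightI[of 0 "1/2"]) (use * in auto)
  show "\<forall>\<^sub>F v in at_right 0. lgt_moment l i v * lgt v ^ j \<le> lgt_moment l (i + j) v"
    by (rule eventually_at_rightI[of 0 "1/2"]) (use * in auto)
qed

text \<open>\<open>1 - v powr l\<close> vanishes to first order at 1, while \<open>lgt\<close> has
  only a logarithmic singularity: with \<open>t = - lgt v\<close> one has
  \<open>exp t = v / (1 - v)\<close>, so up to sign the product is a bounded factor times
  \<open>t^j / exp t\<close>.\<close>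

lemma one_minus_powr_times_lgt_power_at_1:
  fixes l :: real
  assumes "l > 0"
  shows "((\<lambda>v. (1 - v powr l) * lgt v ^ j) \<longlongrightarrow> 0) (at_left 1)"
proof -
  have "((\<lambda>v. (1 - v powr l) / (1 - v) * v) \<longlongrightarrow> l) (at_left 1)"
    by real_asymp
  moreover have lim: "filterlim (\<lambda>v. - lgt v) at_top (at_left 1)"
    unfolding lgt_def by real_asymp
  have "((\<lambda>v. (-1) ^ j * ((- lgt v) ^ j / exp (- lgt v))) \<longlongrightarrow> (-1) ^ j * 0) (at_left 1)"
    by (intro tendsto_mult tendsto_const filterlim_compose[OF tendsto_power_div_exp_0 lim])
  ultimately have "((\<lambda>v. (1 - v powr l) / (1 - v) * v *
      ((-1) ^ j * ((- lgt v) ^ j / exp (- lgt v)))) \<longlongrightarrow> l * ((-1) ^ j * 0)) (at_left 1)"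
    by (rule tendsto_mult)
  moreover have "\<forall>\<^sub>F v in at_left 1. (1 - v powr l) / (1 - v) * v *
      ((-1) ^ j * ((- lgt v) ^ j / exp (- lgt v))) = (1 - v powr l) * lgt v ^ j"
  proof (rule eventually_at_leftI[of 0])
    fix v :: real assume "v \<in> {0<..<1}"
    hence "exp (- lgt v) = v / (1 - v)" by (simp add: lgt_def exp_diff)
    moreover have "(-1) ^ j * (- lgt v) ^ j = lgt v ^ j"
      by (simp flip: power_mult_distrib)
    moreover have "(-1) ^ j * ((- lgt v) ^ j / exp (- lgt v)) = (-1) ^ j * (- lgt v) ^ j / exp (- lgt v)"
      by simp
    ultimately have "(-1) ^ j * ((- lgt v) ^ j / exp (- lgt v)) = lgt v ^ j / (v / (1 - v))"
      by simp
    thus "(1 - v powr l) / (1 - v) * v *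
      ((-1) ^ j * ((- lgt v) ^ j / exp (- lgt v))) = (1 - v powr l) * lgt v ^ j"
      using \<open>v \<in> {0<..<1}\<close> by simp
  qed simp
  ultimately show ?thesis by (simp add: tendsto_cong)
qed

section \<open>Central moments as iterated integrals\<close>

text \<open>At \<open>v = 1\<close> this is \<open>E exp (z X)\<close> as a formal series in
  \<open>z\<close>.\<close>

definition mom_fps :: "real \<Rightarrow> real \<Rightarrow> real fps" where
  "mom_fps l v = Abs_fps (\<lambda>i. lgt_moment l i v / fact i)"

text \<open>This is \<open>E [(X - lgt v)\<^sup>k; V \<le> v] / k!\<close>.\<close>

definition trunc_moment :: "real \<Rightarrow> nat \<Rightarrow> real \<Rightarrow> real" where
  "trunc_moment l k v = fps_nth (mom_fps l v * fps_exp (- lgt v)) k"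

lemma trunc_moment_altdef:
  "trunc_moment l k v = (\<Sum>i\<le>k. lgt_moment l i v / fact i * ((- lgt v) ^ (k - i) / fact (k - i)))"
  by (simp add: trunc_moment_def fps_mult_nth mom_fps_def atMost_atLeast0)

lemma fact_Suc_cancel: "real (Suc n) * x * (1 / y) / fact (Suc n) = x / fact n / y"
  by (cases "y = 0") (auto simp: field_simps simp del: of_nat_Suc)

lemma has_real_derivative_lgt_power:
  assumes "0 < v" "v < 1"
  shows "((\<lambda>v. (- lgt v) ^ Suc n / fact (Suc n)) has_real_derivative
           (- lgt v) ^ n / fact n / (v * (1 - v))) (at v)"
proof -
  have "((\<lambda>v. (- lgt v) ^ Suc n / fact (Suc n)) has_real_derivative
          (real (Suc n) * (- lgt v) ^ n * (1 / (v * (1 - v)))) / fact (Suc n)) (at v)"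
    using DERIV_cdivide[OF DERIV_power[OF DERIV_minus[OF has_real_derivative_lgt[OF assms]], of "Suc n"],
        of "fact (Suc n)"] by (simp add: mult_ac)
  also have "(real (Suc n) * (- lgt v) ^ n * (1 / (v * (1 - v)))) / fact (Suc n) =
             (- lgt v) ^ n / fact n / (v * (1 - v))"
    by (rule fact_Suc_cancel)
  finally show ?thesis .
qed

text \<open>Moving the endpoint contributes a coefficient of
  \<open>exp (z lgt v) exp (- z lgt v) = 1\<close> in positive degree, that is 0. Only moving the
  centre counts, and it lowers the order by one, just as removing an outermost \<open>False\<close>
  does.\<close>

lemma has_real_derivative_trunc_moment:
  assumes l: "l > 0" and v: "0 < v" "v < 1"
  shows "(trunc_moment l (Suc k) has_real_derivative trunc_moment l k v / (v * (1 - v))) (at v)"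
proof -
  let ?a = "\<lambda>i v. lgt_moment l i v / fact i" and ?b = "\<lambda>n v. (- lgt v) ^ n / fact n :: real"
  let ?d = "l * v powr (l - 1)"
  have a: "(?a i has_real_derivative ?d * (lgt v ^ i / fact i)) (at v)" for i
    using DERIV_cdivide[OF has_real_derivative_lgt_moment[OF l v, of i], of "fact i"] by simp
  have "((\<lambda>v. (\<Sum>i\<le>k. ?a i v * ?b (Suc (k - i)) v) + ?a (Suc k) v) has_real_derivative
          (\<Sum>i\<le>k. ?d * (lgt v ^ i / fact i) * ?b (Suc (k - i)) v +
                   ?b (k - i) v / (v * (1 - v)) * ?a i v) + ?d * (lgt v ^ Suc k / fact (Suc k))) (at v)"
    by (intro DERIV_add DERIV_sum DERIV_mult a has_real_derivative_lgt_power v)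
  also have "(\<lambda>v. (\<Sum>i\<le>k. ?a i v * ?b (Suc (k - i)) v) + ?a (Suc k) v) = trunc_moment l (Suc k)"
    unfolding trunc_moment_altdef by (auto simp: Suc_diff_le)
  also have "(\<Sum>i\<le>k. ?d * (lgt v ^ i / fact i) * ?b (Suc (k - i)) v +
               ?b (k - i) v / (v * (1 - v)) * ?a i v) + ?d * (lgt v ^ Suc k / fact (Suc k)) =
             ?d * ((\<Sum>i\<le>k. lgt v ^ i / fact i * ?b (Suc k - i) v) + lgt v ^ Suc k / fact (Suc k)) +
             trunc_moment l k v / (v * (1 - v))"
    unfolding trunc_moment_altdef
    by (simp add: sum.distrib sum_distrib_left sum_divide_distrib distrib_left Suc_diff_le mult_ac
             del: power_Suc fact_Suc)
  also have "(\<Sum>i\<le>k. lgt v ^ i / fact i * ?b (Suc k - i) v) + lgt v ^ Suc k / fact (Suc k) =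
             fps_nth (fps_exp (lgt v) * fps_exp (- lgt v)) (Suc k)"
    by (simp add: fps_mult_nth atLeast0AtMost del: power_Suc fact_Suc)
  also have "fps_exp (lgt v) * fps_exp (- lgt v) = 1"
    by (simp flip: fps_exp_add_mult)
  finally show ?thesis by simp
qed

lemma trunc_moment_at_0: "l > 0 \<Longrightarrow> (trunc_moment l k \<longlongrightarrow> 0) (at_right 0)"
proof -
  assume l: "l > 0"
  have "((\<lambda>v. \<Sum>i\<le>k. lgt_moment l i v * lgt v ^ (k - i) * ((-1) ^ (k - i) / (fact i * fact (k - i)))) \<longlongrightarrow>
          (\<Sum>i\<le>k. 0 * ((-1) ^ (k - i) / (fact i * fact (k - i))))) (at_right 0)"
    by (intro tendsto_sum tendsto_mult tendsto_const lgt_moment_times_power_at_0 l)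
  also have "(\<lambda>v. \<Sum>i\<le>k. lgt_moment l i v * lgt v ^ (k - i) * ((-1) ^ (k - i) / (fact i * fact (k - i))))
               = trunc_moment l k"
    unfolding trunc_moment_altdef by (subst power_minus) (simp add: mult_ac)
  finally show ?thesis by simp
qed

lemma trunc_moment_0:
  assumes l: "l > 0" and v: "0 < v" "v < 1"
  shows "trunc_moment l 0 v = v powr l"
proof (rule eq_if_same_derivative[where c = 0 and d = "\<lambda>v. l * v powr (l - 1)", OF _ _ trunc_moment_at_0[OF l] _ v])
  fix v :: real assume v: "0 < v" "v < 1"
  show "(trunc_moment l 0 has_real_derivative l * v powr (l - 1)) (at v)"
    using has_real_derivative_lgt_moment[OF l v, of 0] by (simp add: trunc_moment_altdef[abs_def])
  show "((\<lambda>v. v powr l) has_real_derivative l * v powr (l - 1)) (at v)"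
    using v by (auto intro!: derivative_eq_intros)
next
  show "((\<lambda>v. v powr l) \<longlongrightarrow> 0) (at_right 0)"
    using l by (intro tendsto_zero_powrI tendsto_ident_at tendsto_const eventually_at_rightI[of 0 1]) auto
qed

section \<open>Words for truncated moments and for divided powers\<close>

text \<open>For \<open>k > 0\<close> the integral of this word is the truncated moment of order
  \<open>k\<close>. For \<open>k = 0\<close> the empty word gives 1 instead of
  \<open>v powr l\<close>; the difference becomes the correction term in
  \<open>central_comb_tendsto_moment\<close>.\<close>

definition bword :: "nat \<Rightarrow> bool list" where
  "bword k = (if k = 0 then [] else replicate (k - 1) False @ [True])"

lemma bword_simps [simp]: "bword 0 = []" "bword (Suc 0) = [True]"
    "bword (Suc (Suc k)) = False # bword (Suc k)"
  by (simp_all add: bword_def)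

lemma bword_eq_Nil_iff [simp]: "bword k = [] \<longleftrightarrow> k = 0"
  by (simp add: bword_def)

lemma regular_bword: "regular_word (bword k)"
  by (simp add: bword_def regular_word_def)

lemma regular_replicate_True: "regular_word (replicate k True)"
  by (simp add: regular_word_def last_replicate)

text \<open>Both sides obey one differential recursion: the innermost \<open>True\<close> integrates
  \<open>trunc_moment l 0\<close>, which is \<open>v powr l\<close>, and each \<open>False\<close>
  raises the order by one.\<close>

lemma iterint_bword:
  assumes l: "l > 0" and v: "0 < v" "v < 1"
  shows "iterint l (bword (Suc k)) v = trunc_moment l (Suc k) v"
  using v
proof (induction k arbitrary: v)
  case 0
  show ?case
  proof (rule eq_if_same_derivative[where c = 0, OF _ _ iterint_tendsto_0 trunc_moment_at_0])
    fix v :: real assume v: "0 < v" "v < 1"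
    show "(iterint l (bword (Suc 0)) has_real_derivative trunc_moment l 0 v / (v * (1 - v))) (at v)"
      using has_real_derivative_iterint[OF l _ v, of True "[]"] v
      by (simp add: trunc_moment_0[OF l] letter_def iterint_Nil regular_word_Cons)
    show "(trunc_moment l (Suc 0) has_real_derivative trunc_moment l 0 v / (v * (1 - v))) (at v)"
      by (rule has_real_derivative_trunc_moment[OF l v])
  qed (use l 0 regular_bword[of "Suc 0"] in auto)
next
  case (Suc k)
  show ?case
  proof (rule eq_if_same_derivative[where c = 0, OF _ _ iterint_tendsto_0 trunc_moment_at_0])
    fix v :: real assume v: "0 < v" "v < 1"
    show "(iterint l (bword (Suc (Suc k))) has_real_derivative trunc_moment l (Suc k) v / (v * (1 - v))) (at v)"
      using has_real_derivative_iterint[OF l regular_bword[of "Suc (Suc k)", unfolded bword_simps] v]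
      by (simp add: Suc.IH[OF v] letter_def)
    show "(trunc_moment l (Suc (Suc k)) has_real_derivative trunc_moment l (Suc k) v / (v * (1 - v))) (at v)"
      by (rule has_real_derivative_trunc_moment[OF l v])
  qed (use l Suc.prems regular_bword[of "Suc (Suc k)"] in auto)
qed

lemma iterint_replicate_True:
  assumes l: "l > 0" and v: "0 < v" "v < 1"
  shows "iterint l (replicate k True) v = iterint l [True] v ^ k / fact k"
  using v
proof (induction k arbitrary: v)
  case 0
  thus ?case by (simp add: iterint_Nil)
next
  case (Suc k)
  have r: "regular_word [True]" by (simp add: regular_word_def)
  show ?case
  proof (rule eq_if_same_derivative[where c = 0, OF _ _ iterint_tendsto_0])
    fix v :: real assume v: "0 < v" "v < 1"
    let ?d = "letter l True v * (iterint l [True] v ^ k / fact k) / (v * (1 - v))"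
    show "(iterint l (replicate (Suc k) True) has_real_derivative ?d) (at v)"
      using has_real_derivative_iterint[OF l regular_replicate_True[of "Suc k", unfolded replicate_Suc] v]
      by (simp add: Suc.IH[OF v])
    have "((\<lambda>v. iterint l [True] v ^ Suc k / fact (Suc k)) has_real_derivative
            (real (Suc k) * (letter l True v * iterint l [True] v ^ k) * (1 / (v * (1 - v)))) / fact (Suc k)) (at v)"
      using DERIV_cdivide[OF DERIV_power[OF has_real_derivative_iterint[OF l r v], of "Suc k"], of "fact (Suc k)"] v
      by (simp add: iterint_Nil mult_ac)
    also have "(real (Suc k) * (letter l True v * iterint l [True] v ^ k) * (1 / (v * (1 - v)))) / fact (Suc k) = ?d"
      by (subst fact_Suc_cancel) simp
    finally show "((\<lambda>v. iterint l [True] v ^ Suc k / fact (Suc k)) has_real_derivative ?d) (at v)" .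
  next
    have "((\<lambda>v. iterint l [True] v ^ Suc k / fact (Suc k)) \<longlongrightarrow> 0 ^ Suc k / fact (Suc k)) (at_right 0)"
      by (intro tendsto_intros iterint_tendsto_0 l r) auto
    thus "((\<lambda>v. iterint l [True] v ^ Suc k / fact (Suc k)) \<longlongrightarrow> 0) (at_right 0)" by simp
  qed (use l Suc.prems regular_replicate_True[of "Suc k"] in auto)
qed

lemma iterint_Nil_at_0: "(iterint l [] \<longlongrightarrow> 1) (at_right 0)"
proof (rule Lim_transform_eventually[OF tendsto_const])
  show "\<forall>\<^sub>F v in at_right 0. 1 = iterint l [] v"
    by (rule eventually_at_rightI[of 0 1]) (auto simp: iterint_Nil)
qed

text \<open>
  The factors \<open>(-1)\<^sup>j iterint l (replicate j True)\<close> are the coefficients of \<open>exp (- z I)\<close> for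
  \<open>I = iterint l [True]\<close>, and \<open>I + lgt v\<close> tends to \<open>E X\<close>: the combination replaces the divergent
  centre \<open>lgt v\<close> by \<open>E X\<close>.
\<close>

definition central_comb :: "real \<Rightarrow> nat \<Rightarrow> real \<Rightarrow> real" where
  "central_comb l k v = (\<Sum>j\<le>k. (-1) ^ j * iterint l (bword (k - j)) v * iterint l (replicate j True) v)"

text \<open>Differentiation strips a \<open>False\<close> from \<open>bword\<close> or a
  \<open>True\<close> from the other factor. After an index shift both kinds of terms contain the
  same sum of products, with weights 1 and \<open>- (v powr l)\<close>, and the boundary terms
  cancel. So the outermost form is the difference form, and the products under it are
  shuffled.\<close>

lemma central_comb_conv_diffint:
  assumes l: "l > 0" and v: "0 < v" "v < 1"
  shows "central_comb l (Suc (Suc k)) v =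
           (\<Sum>j\<le>k. (-1) ^ j * (\<Sum>x\<leftarrow>shuffle_list (bword (Suc (k - j))) (replicate j True). diffint l x v))"
proof (rule eq_if_same_derivative[where c = 0, OF _ _ _ _ v])
  have reg: "regular_word x \<and> x \<noteq> []"
    if "x \<in> set (shuffle_list (bword (Suc (k - j))) (replicate j True))" for x j
    by (rule regular_shuffle_list_nonempty[OF _ _ _ that]) (auto simp: regular_bword regular_replicate_True)
  {
    fix v :: real assume v: "0 < v" "v < 1"
    let ?B = "\<lambda>i. iterint l (bword i) v" and ?A = "\<lambda>j. iterint l (replicate j True) v"
    let ?k = "1 / (v * (1 - v))"
    let ?D = "(1 - v powr l) * (\<Sum>j\<le>k. (-1) ^ j * (?B (Suc (k - j)) * ?A j)) * ?k"
    show "((\<lambda>v. \<Sum>j\<le>k. (-1) ^ j * (\<Sum>x\<leftarrow>shuffle_list (bword (Suc (k - j))) (replicate j True). diffint l x v))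
             has_real_derivative ?D) (at v)"
    proof -
      have "((\<lambda>v. \<Sum>j\<le>k. (-1) ^ j * (\<Sum>x\<leftarrow>shuffle_list (bword (Suc (k - j))) (replicate j True). diffint l x v))
             has_real_derivative (\<Sum>j\<le>k. (-1) ^ j * ((1 - v powr l) *
               (\<Sum>x\<leftarrow>shuffle_list (bword (Suc (k - j))) (replicate j True). iterint l x v) / (v * (1 - v))))) (at v)"
        by (intro DERIV_sum DERIV_cmult has_real_derivative_diffint_sum_list l v reg)
      also have "(\<Sum>j\<le>k. (-1) ^ j * ((1 - v powr l) *
               (\<Sum>x\<leftarrow>shuffle_list (bword (Suc (k - j))) (replicate j True). iterint l x v) / (v * (1 - v)))) = ?D"
        unfolding sum_distrib_left sum_distrib_right
        by (intro sum.cong refl)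
           (simp flip: iterint_shuffle[OF l regular_bword regular_replicate_True v])
      finally show ?thesis .
    qed
    \<comment> \<open>\<open>iterint_Nil\<close> is about positive arguments, so the comparison with
      the constant 1 is made on a neighbourhood inside \<open>(0, 1)\<close>.\<close>
    have B0: "((\<lambda>v. iterint l (bword 0) v) has_real_derivative 0) (at v)"
    proof (rule DERIV_cong_ev[THEN iffD1, OF refl _ refl, of "\<lambda>_. 1"])
      have "\<forall>\<^sub>F x in nhds v. x \<in> {0<..<1}" using v by (intro eventually_nhds_in_open) auto
      thus "\<forall>\<^sub>F x in nhds v. 1 = iterint l (bword 0) x"
        by eventually_elim (simp add: iterint_Nil)
    qed auto
    have B1: "((\<lambda>v. iterint l (bword (Suc 0)) v) has_real_derivative v powr l * ?k) (at v)"
      using has_real_derivative_iterint[OF l regular_bword[of "Suc 0", unfolded bword_simps] v] v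
      by (simp add: letter_def iterint_Nil)
    have B2: "((\<lambda>v. iterint l (bword (Suc (Suc n))) v) has_real_derivative ?B (Suc n) * ?k) (at v)" for n
      using has_real_derivative_iterint[OF l regular_bword[of "Suc (Suc n)", unfolded bword_simps] v]
      by (simp add: letter_def)
    have A0: "((\<lambda>v. iterint l (replicate 0 True) v) has_real_derivative 0) (at v)"
      using B0 by simp
    have A1: "((\<lambda>v. iterint l (replicate (Suc n) True) v) has_real_derivative v powr l * ?A n * ?k) (at v)" for n
      using has_real_derivative_iterint[OF l regular_replicate_True[of "Suc n", unfolded replicate_Suc] v]
      by (simp add: letter_def)
    have A: "((\<lambda>v. iterint l (replicate j True) v) has_real_derivative
               (if j = 0 then 0 else v powr l * ?A (j - 1) * ?k)) (at v)" for j
      using A0 A1 by (cases j) auto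
    have B: "((\<lambda>v. iterint l (bword j) v) has_real_derivative
               (if j = 0 then 0 else if j = 1 then v powr l * ?k else ?B (j - 1) * ?k)) (at v)" for j
    proof -
      consider "j = 0" | "j = 1" | n where "j = Suc (Suc n)" by (metis not0_implies_Suc One_nat_def)
      thus ?thesis using B0 B1 B2 by cases auto
    qed
    let ?K = "Suc (Suc k)"
    have d: "((\<lambda>v. central_comb l ?K v) has_real_derivative
        (\<Sum>j\<le>?K. (-1) ^ j * (if ?K - j = 0 then 0 else if ?K - j = 1 then v powr l * ?k else ?B (?K - j - 1) * ?k) * ?A j +
               (if j = 0 then 0 else v powr l * ?A (j - 1) * ?k) * ((-1) ^ j * ?B (?K - j)))) (at v)"
      unfolding central_comb_def by (intro DERIV_sum DERIV_mult DERIV_cmult A B)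
    \<comment> \<open>The summand \<open>j = k + 1\<close> involves \<open>bword 1 = [True]\<close>,
      whose derivative carries \<open>v powr l\<close>; the summand \<open>j = k + 2\<close>
      involves the empty word and drops out.\<close>
    have S1: "(\<Sum>j\<le>?K. (-1) ^ j * (if ?K - j = 0 then 0 else if ?K - j = 1 then v powr l * ?k else ?B (?K - j - 1) * ?k) * ?A j)
           = (\<Sum>j\<le>k. (-1) ^ j * (?B (Suc (k - j)) * ?A j)) * ?k + (-1) ^ Suc k * (v powr l * ?k) * ?A (Suc k)"
    proof -
      have "(\<Sum>j\<le>k. (-1) ^ j * (if ?K - j = 0 then 0 else if ?K - j = 1 then v powr l * ?k else ?B (?K - j - 1) * ?k) * ?A j)
              = (\<Sum>j\<le>k. (-1) ^ j * (?B (Suc (k - j)) * ?A j)) * ?k"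
        unfolding sum_distrib_right by (intro sum.cong refl) (auto simp: Suc_diff_le)
      thus ?thesis by simp
    qed
    \<comment> \<open>Shifting \<open>j\<close> by one flips the sign and reproduces the sum from
      \<open>S1\<close>; the new last summand cancels the boundary term there.\<close>
    have S2: "(\<Sum>j\<le>?K. (if j = 0 then 0 else v powr l * ?A (j - 1) * ?k) * ((-1) ^ j * ?B (?K - j))) =
       - (v powr l * ?k * (\<Sum>j\<le>k. (-1) ^ j * (?B (Suc (k - j)) * ?A j))) - (-1) ^ Suc k * (v powr l * ?k) * ?A (Suc k)"
    proof -
      have "(\<Sum>j\<le>?K. (if j = 0 then 0 else v powr l * ?A (j - 1) * ?k) * ((-1) ^ j * ?B (?K - j))) =
            (\<Sum>j\<le>Suc k. (v powr l * ?A j * ?k) * ((-1) ^ Suc j * ?B (Suc k - j)))"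
        by (subst sum.atMost_Suc_shift) simp
      also have "\<dots> = (\<Sum>j\<le>k. (v powr l * ?A j * ?k) * ((-1) ^ Suc j * ?B (Suc k - j)))
                   + (v powr l * ?A (Suc k) * ?k) * (-1) ^ Suc (Suc k)"
        using v by (simp add: iterint_Nil)
      also have "(\<Sum>j\<le>k. (v powr l * ?A j * ?k) * ((-1) ^ Suc j * ?B (Suc k - j))) =
                 - (v powr l * ?k * (\<Sum>j\<le>k. (-1) ^ j * (?B (Suc (k - j)) * ?A j)))"
        unfolding sum_distrib_left sum_negf[symmetric]
        by (intro sum.cong refl) (auto simp: Suc_diff_le)
      finally show ?thesis by simp
    qed
    show "(central_comb l ?K has_real_derivative ?D) (at v)"
      using d unfolding sum.distrib S1 S2 by (simp only: left_diff_distrib) (simp add: algebra_simps)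
  }
  have z: "(iterint l (bword (Suc (Suc k) - j)) \<longlongrightarrow> (if j = Suc (Suc k) then 1 else 0)) (at_right 0)"
    if "j \<le> Suc (Suc k)" for j
  proof (cases "j = Suc (Suc k)")
    case True
    thus ?thesis using iterint_Nil_at_0 by simp
  next
    case False
    thus ?thesis using that by (auto intro!: iterint_tendsto_0 l regular_bword)
  qed
  have z': "(iterint l (replicate j True) \<longlongrightarrow> (if j = 0 then 1 else 0)) (at_right 0)" for j
  proof (cases "j = 0")
    case True
    thus ?thesis using iterint_Nil_at_0 by simp
  next
    case False
    thus ?thesis by (auto intro!: iterint_tendsto_0 l regular_replicate_True)
  qed
  have "((\<lambda>v. central_comb l (Suc (Suc k)) v) \<longlongrightarrow>
          (\<Sum>j\<le>Suc (Suc k). (-1) ^ j * (if j = Suc (Suc k) then 1 else 0) * (if j = 0 then 1 else 0))) (at_right 0)"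
    unfolding central_comb_def by (intro tendsto_sum tendsto_mult tendsto_const z z') auto
  \<comment> \<open>A nonzero limit would need both words empty, that is \<open>j = k + 2\<close>
    and \<open>j = 0\<close> at once.\<close>
  also have "(\<Sum>j\<le>Suc (Suc k). (-1) ^ j * (if j = Suc (Suc k) then 1 else 0) * (if j = 0 then 1 else 0)) = (0::real)"
    by (rule sum.neutral) auto
  finally show "(central_comb l (Suc (Suc k)) \<longlongrightarrow> 0) (at_right 0)" .
  have "((\<lambda>v. \<Sum>j\<le>k. (-1) ^ j * (\<Sum>x\<leftarrow>shuffle_list (bword (Suc (k - j))) (replicate j True). diffint l x v)) \<longlongrightarrow>
          (\<Sum>j\<le>k. (-1) ^ j * 0)) (at_right 0)"
    by (intro tendsto_sum tendsto_mult tendsto_const tendsto_sum_list_0)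
       (use reg diffint_tendsto_0[OF l] in blast)
  thus "((\<lambda>v. \<Sum>j\<le>k. (-1) ^ j * (\<Sum>x\<leftarrow>shuffle_list (bword (Suc (k - j))) (replicate j True). diffint l x v)) \<longlongrightarrow> 0) (at_right 0)"
    by simp
qed

text \<open>Termwise limit of the preceding identity; the only coefficients are signs.\<close>

lemma central_comb_tendsto_Dring:
  assumes l: "l > 0"
  shows "\<exists>c\<in>Dring l. (central_comb l (Suc (Suc k)) \<longlongrightarrow> c) (at_left 1)"
proof -
  let ?c = "\<Sum>j\<le>k. (-1) ^ j * (\<Sum>x\<leftarrow>shuffle_list (bword (Suc (k - j))) (replicate j True). Dint l x)"
  have reg: "regular_word x \<and> x \<noteq> []"
    if "x \<in> set (shuffle_list (bword (Suc (k - j))) (replicate j True))" for x j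
    by (rule regular_shuffle_list_nonempty[OF _ _ _ that]) (auto simp: regular_bword regular_replicate_True)
  have "((\<lambda>v. \<Sum>j\<le>k. (-1) ^ j * (\<Sum>x\<leftarrow>shuffle_list (bword (Suc (k - j))) (replicate j True). diffint l x v)) \<longlongrightarrow> ?c) (at_left 1)"
    by (intro tendsto_sum tendsto_mult tendsto_const tendsto_sum_list)
       (use reg diffint_tendsto_Dint[OF l] in blast)
  moreover have "\<forall>\<^sub>F v in at_left 1. central_comb l (Suc (Suc k)) v =
      (\<Sum>j\<le>k. (-1) ^ j * (\<Sum>x\<leftarrow>shuffle_list (bword (Suc (k - j))) (replicate j True). diffint l x v))"
    by (rule eventually_at_leftI[of 0]) (auto simp: central_comb_conv_diffint[OF l])
  ultimately have "(central_comb l (Suc (Suc k)) \<longlongrightarrow> ?c) (at_left 1)"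
    by (simp add: tendsto_cong)
  moreover have pm: "(-1) ^ j * x \<in> Dring l" if "x \<in> Dring l" for j :: nat and x
    using that Dring_diff[OF Dring_0 that] by (cases "even j") auto
  have "?c \<in> Dring l"
    by (intro Dring_sum pm Dring_sum_list Dring_Dint) (use reg in blast)+
  ultimately show ?thesis by blast
qed

text \<open>With \<open>I = iterint l [True]\<close>, the combination is a coefficient of
  \<open>mom_fps l v * fps_exp (- (lgt v + I))\<close> plus a correction from the empty word. Since
  \<open>I = E [X; V \<le> v] - v^l lgt v\<close>, the centre \<open>lgt v + I\<close> tends to
  \<open>E X\<close>, and the correction contains \<open>1 - v powr l\<close>, which outweighs every
  power of \<open>lgt\<close>.\<close>

lemma central_comb_tendsto_moment:
  assumes l: "l > 0"
  shows "(central_comb l k \<longlongrightarrow>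
           fps_nth (mom_fps l 1 * fps_exp (- lgt_moment l 1 1)) k) (at_left 1)"
proof -
  let ?I = "\<lambda>v. iterint l [True] v"
  have I: "?I v = lgt_moment l 1 v - v powr l * lgt v" if "0 < v" "v < 1" for v
    using iterint_bword[OF l that, of 0] trunc_moment_0[OF l that]
    by (simp add: trunc_moment_altdef)
  have eq: "central_comb l k v = (\<Sum>i\<le>k. lgt_moment l i v / fact i * ((- (lgt v + ?I v)) ^ (k - i) / fact (k - i)))
              + (-1) ^ k * ((1 - v powr l) * ?I v ^ k) / fact k" if v: "0 < v" "v < 1" for v
  proof -
    \<comment> \<open>The conditional term accounts for \<open>bword 0\<close>, where the integral
      is 1 but the truncated moment is \<open>v powr l\<close>.\<close>
    have "central_comb l k v = (\<Sum>j\<le>k. trunc_moment l (k - j) v * ((- ?I v) ^ j / fact j) +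
            (if j = k then (1 - v powr l) * ((- ?I v) ^ j / fact j) else 0))"
      unfolding central_comb_def
    proof (intro sum.cong refl)
      fix j assume "j \<in> {..k}"
      hence j: "j \<le> k" by simp
      have B: "iterint l (bword (k - j)) v = trunc_moment l (k - j) v + (if j = k then 1 - v powr l else 0)"
      proof (cases "j = k")
        case True
        thus ?thesis using trunc_moment_0[OF l v] v by (simp add: iterint_Nil)
      next
        case False
        then obtain n where "k - j = Suc n" using j by (metis Suc_diff_le Suc_diff_Suc diff_is_0_eq le_neq_implies_less)
        thus ?thesis using False by (simp add: iterint_bword[OF l v])
      qed
      have "(-1) ^ j * iterint l (replicate j True) v = (- ?I v) ^ j / fact j"
        unfolding iterint_replicate_True[OF l v] by (subst (2) power_minus) simp
      hence "(-1) ^ j * iterint l (bword (k - j)) v * iterint l (replicate j True) v =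
             iterint l (bword (k - j)) v * ((- ?I v) ^ j / fact j)"
        by (metis mult.assoc mult.commute)
      thus "(-1) ^ j * iterint l (bword (k - j)) v * iterint l (replicate j True) v =
            trunc_moment l (k - j) v * ((- ?I v) ^ j / fact j) +
            (if j = k then (1 - v powr l) * ((- ?I v) ^ j / fact j) else 0)"
        unfolding B by (simp add: distrib_right add_divide_distrib)
    qed
    also have "\<dots> = (\<Sum>j\<le>k. trunc_moment l (k - j) v * ((- ?I v) ^ j / fact j)) +
                     (1 - v powr l) * ((- ?I v) ^ k / fact k)"
      by (simp add: sum.distrib)
    also have "(\<Sum>j\<le>k. trunc_moment l (k - j) v * ((- ?I v) ^ j / fact j)) =
               fps_nth (fps_exp (- ?I v) * (mom_fps l v * fps_exp (- lgt v))) k"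
      unfolding trunc_moment_def by (subst fps_mult_nth) (simp add: atLeast0AtMost mult_ac)
    also have "fps_exp (- ?I v) * (mom_fps l v * fps_exp (- lgt v)) =
               mom_fps l v * fps_exp (- (lgt v + ?I v))"
      by (simp add: fps_exp_add_mult[symmetric] mult_ac)
    also have "fps_nth \<dots> k = (\<Sum>i\<le>k. lgt_moment l i v / fact i * ((- (lgt v + ?I v)) ^ (k - i) / fact (k - i)))"
      by (simp add: fps_mult_nth mom_fps_def atLeast0AtMost)
    also have "(1 - v powr l) * ((- ?I v) ^ k / fact k) = (-1) ^ k * ((1 - v powr l) * ?I v ^ k) / fact k"
      by (subst power_minus) simp
    finally show ?thesis .
  qed
  have ev: "\<forall>\<^sub>F v in at_left (1::real). 0 < v \<and> v < 1"
    by (rule eventually_at_leftI[of 0]) auto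
  have "((\<lambda>v. lgt_moment l 1 v + (1 - v powr l) * lgt v ^ 1) \<longlongrightarrow> lgt_moment l 1 1 + 0) (at_left 1)"
    by (intro tendsto_add lgt_moment_at_1 one_minus_powr_times_lgt_power_at_1 l)
  moreover have "\<forall>\<^sub>F v in at_left 1. lgt v + ?I v = lgt_moment l 1 v + (1 - v powr l) * lgt v ^ 1"
    using ev by eventually_elim (simp add: I algebra_simps)
  ultimately have LI: "((\<lambda>v. lgt v + ?I v) \<longlongrightarrow> lgt_moment l 1 1) (at_left 1)"
    by (simp add: tendsto_cong)
  \<comment> \<open>\<open>I\<close> is written as the convergent \<open>lgt v + I\<close> minus
    \<open>lgt v\<close> and expanded binomially, so that each summand contains
    \<open>(1 - v powr l)\<close> times a power of \<open>lgt v\<close>.\<close>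
  have "((\<lambda>v. \<Sum>i\<le>k. of_nat (k choose i) * (lgt v + ?I v) ^ i * ((-1) ^ (k - i) * ((1 - v powr l) * lgt v ^ (k - i)))) \<longlongrightarrow>
         (\<Sum>i\<le>k. of_nat (k choose i) * lgt_moment l 1 1 ^ i * ((-1) ^ (k - i) * 0))) (at_left 1)"
    by (intro tendsto_sum tendsto_mult tendsto_power tendsto_const LI one_minus_powr_times_lgt_power_at_1 l)
  moreover have "(\<Sum>i\<le>k. of_nat (k choose i) * (lgt v + ?I v) ^ i * ((-1) ^ (k - i) * ((1 - v powr l) * lgt v ^ (k - i))))
      = (1 - v powr l) * ?I v ^ k" for v
  proof -
    have "?I v ^ k = ((lgt v + ?I v) + - lgt v) ^ k" by simp
    also have "\<dots> = (\<Sum>i\<le>k. of_nat (k choose i) * (lgt v + ?I v) ^ i * ((-1) ^ (k - i) * lgt v ^ (k - i)))"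
      unfolding binomial_ring by (subst power_minus) simp
    finally show ?thesis by (simp only: sum_distrib_left mult_ac)
  qed
  ultimately have rest: "((\<lambda>v. (1 - v powr l) * ?I v ^ k) \<longlongrightarrow> 0) (at_left 1)" by simp
  have "((\<lambda>v. (\<Sum>i\<le>k. lgt_moment l i v / fact i * ((- (lgt v + ?I v)) ^ (k - i) / fact (k - i)))
              + (-1) ^ k * ((1 - v powr l) * ?I v ^ k) / fact k) \<longlongrightarrow>
         (\<Sum>i\<le>k. lgt_moment l i 1 / fact i * ((- lgt_moment l 1 1) ^ (k - i) / fact (k - i)))
              + (-1) ^ k * 0 / fact k) (at_left 1)"
    by (intro tendsto_add tendsto_sum tendsto_mult tendsto_divide tendsto_power tendsto_minus tendsto_const
          rest LI lgt_moment_at_1 l) auto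
  also have "(\<Sum>i\<le>k. lgt_moment l i 1 / fact i * ((- lgt_moment l 1 1) ^ (k - i) / fact (k - i)))
              + (-1) ^ k * 0 / fact k = fps_nth (mom_fps l 1 * fps_exp (- lgt_moment l 1 1)) k"
    by (simp add: fps_mult_nth mom_fps_def atLeast0AtMost)
  finally show ?thesis
    by (rule Lim_transform_eventually) (use ev in eventually_elim, simp add: eq)
qed

section \<open>Cumulants\<close>

lemma has_fps_expansion_higher_deriv:
  fixes f :: "'a :: {banach, real_normed_field} \<Rightarrow> 'a"
  assumes "f has_fps_expansion F"
  shows "fps_nth F n * fact n = (deriv ^^ n) f 0"
  using assms
proof (induction n arbitrary: f F)
  case 0
  hence "\<forall>\<^sub>F z in nhds 0. eval_fps F z = f z"
    by (simp add: has_fps_expansion_def)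
  hence "eval_fps F 0 = f 0"
    by (rule eventually_nhds_x_imp_x)
  thus ?case by (simp add: eval_fps_at_0)
next
  case (Suc n)
  have "fps_nth F (Suc n) * fact (Suc n) = fps_nth (fps_deriv F) n * fact n"
    by (simp add: mult_ac)
  also have "\<dots> = (deriv ^^ n) (deriv f) 0"
    by (rule Suc.IH[OF has_fps_expansion_deriv[OF Suc.prems]])
  finally show ?case by (simp only: funpow_Suc_right o_def)
qed

lemma has_fps_expansion_unique:
  fixes f :: "'a :: {banach, real_normed_field} \<Rightarrow> 'a"
  assumes "f has_fps_expansion F" "f has_fps_expansion G"
  shows "F = G"
proof (rule fps_ext)
  fix n
  have "fps_nth F n * fact n = fps_nth G n * fact n"
    using assms[THEN has_fps_expansion_higher_deriv] by simp
  moreover have "(fact n :: 'a) \<noteq> 0" by (rule fact_nonzero)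
  ultimately show "fps_nth F n = fps_nth G n" by simp
qed

lemma has_fps_expansion_uminus_arg:
  fixes f :: "'a :: {banach, real_normed_field} \<Rightarrow> 'a"
  assumes "f has_fps_expansion F"
  shows "(\<lambda>x. f (- x)) has_fps_expansion Abs_fps (\<lambda>n. (-1) ^ n * fps_nth F n)"
  unfolding has_fps_expansion_def
proof
  show "fps_conv_radius (Abs_fps (\<lambda>n. (-1) ^ n * fps_nth F n)) > 0"
    using assms by (simp add: has_fps_expansion_def fps_conv_radius_def conv_radius_def norm_mult norm_power)
  have ev: "\<forall>\<^sub>F z in nhds 0. eval_fps F z = f z"
    using assms by (simp add: has_fps_expansion_def)
  have "filterlim (\<lambda>x::'a. - x) (nhds 0) (nhds 0)"
    using tendsto_minus[OF filterlim_ident[of "nhds (0::'a)"]] by simp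
  hence "\<forall>\<^sub>F x in nhds 0. eval_fps F (- x) = f (- x)"
    by (rule eventually_compose_filterlim[OF ev])
  thus "\<forall>\<^sub>F z in nhds 0. eval_fps (Abs_fps (\<lambda>n. (-1) ^ n * fps_nth F n)) z = f (- z)"
  proof eventually_elim
    case (elim x)
    have "(-1) ^ n * fps_nth F n * x ^ n = fps_nth F n * (- x) ^ n" for n
      by (subst power_minus) (simp add: mult_ac)
    thus ?case using elim by (simp only: eval_fps_def fps_nth_Abs_fps)
  qed
qed

text \<open>Near \<open>a\<close> the complex Digamma function is holomorphic and equals its Taylor
  series, whose coefficients are real. Restriction to real arguments gives the real expansion with
  the same radius of convergence.\<close>

lemma has_fps_expansion_Digamma_real:
  fixes a :: real
  assumes a: "a > 0"
  shows "(\<lambda>x. Digamma (a + x)) has_fps_expansion Abs_fps (\<lambda>n. Polygamma n a / fact n)"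
  unfolding has_fps_expansion_def
proof
  let ?c = "\<lambda>n. Polygamma n a / fact n" and ?F = "fps_expansion Digamma (complex_of_real a)"
  have a': "complex_of_real a \<notin> \<int>\<^sub>\<le>\<^sub>0"
  proof
    assume "complex_of_real a \<in> \<int>\<^sub>\<le>\<^sub>0"
    then obtain n where "complex_of_real a = of_real (of_int n)" "n \<le> 0"
      by (auto elim!: nonpos_Ints_cases)
    thus False using a by (simp only: of_real_eq_iff)
  qed
  have "(Digamma :: complex \<Rightarrow> complex) analytic_on {of_real a}"
    using a' by (intro analytic_on_Polygamma) auto
  hence F: "(\<lambda>x. Digamma (of_real a + x)) has_fps_expansion ?F"
    by (rule analytic_at_imp_has_fps_expansion)
  have nth: "fps_nth ?F n = of_real (?c n)" for n
    unfolding fps_expansion_def using a a'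
    by (simp add: higher_deriv_Polygamma Polygamma_of_real)
  have rad: "fps_conv_radius (Abs_fps ?c) = fps_conv_radius ?F"
    unfolding fps_conv_radius_def conv_radius_def nth fps_nth_Abs_fps norm_of_real real_norm_def ..
  show "fps_conv_radius (Abs_fps ?c) > 0"
    unfolding rad using F by (simp add: has_fps_expansion_def)
  have ev: "\<forall>\<^sub>F z in nhds 0. eval_fps ?F z = Digamma (of_real a + z)"
    using F by (simp add: has_fps_expansion_def)
  have "filterlim complex_of_real (nhds 0) (nhds 0)"
    using tendsto_of_real[OF filterlim_ident[of "nhds (0::real)"]] by simp
  hence "\<forall>\<^sub>F x in nhds 0. eval_fps ?F (complex_of_real x) = Digamma (of_real a + of_real x)"
    by (rule eventually_compose_filterlim[OF ev])
  moreover have "\<forall>\<^sub>F x in nhds 0. x \<in> {-a<..<a}"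
    using a by (intro eventually_nhds_in_open) auto
  moreover have "\<forall>\<^sub>F x in nhds (0::real). x \<in> eball 0 (fps_conv_radius (Abs_fps ?c))"
    using F unfolding rad
    by (intro eventually_nhds_in_open) (auto simp: has_fps_expansion_def zero_ereal_def)
  ultimately show "\<forall>\<^sub>F x in nhds 0. eval_fps (Abs_fps ?c) x = Digamma (a + x)"
  proof eventually_elim
    case (elim x)
    have "summable (\<lambda>n. fps_nth (Abs_fps ?c) n * x ^ n)"
      using elim(3) by (intro summable_fps) (auto simp: eball_def dist_norm)
    hence "(\<Sum>n. complex_of_real (?c n * x ^ n)) = of_real (\<Sum>n. ?c n * x ^ n)"
      by (intro suminf_of_real[symmetric]) simp
    hence "eval_fps ?F (complex_of_real x) = of_real (eval_fps (Abs_fps ?c) x)"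
      by (simp add: eval_fps_def nth)
    moreover have "Digamma (complex_of_real a + of_real x) = of_real (Digamma (a + x))"
      using elim(2) by (subst of_real_add[symmetric], subst Polygamma_of_real) auto
    ultimately show ?case using elim(1) by simp
  qed
qed

lemma has_fps_expansion_moment:
  assumes l: "l > 0"
  shows "(\<lambda>z. l * Beta (l - z) (1 + z)) has_fps_expansion mom_fps l 1"
  unfolding has_fps_expansion_def
proof
  define r where "r = min 1 l / 2"
  have r: "r > 0" using l by (simp add: r_def)
  have s: "(\<lambda>i. fps_nth (mom_fps l 1) i * z ^ i) sums (l * Beta (l - z) (1 + z))" if "\<bar>z\<bar> < r" for z
    using lgt_moment_sums[OF l that[unfolded r_def]] by (simp add: mom_fps_def)
  have "conv_radius (fps_nth (mom_fps l 1)) \<ge> norm (r / 2)"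
    by (rule conv_radius_geI) (use s[of "r / 2"] r in \<open>auto simp: sums_iff\<close>)
  thus "fps_conv_radius (mom_fps l 1) > 0"
    unfolding fps_conv_radius_def using r by (auto intro: less_le_trans[rotated])
  have "\<forall>\<^sub>F z in nhds 0. z \<in> {-r<..<r}" using r by (intro eventually_nhds_in_open) auto
  thus "\<forall>\<^sub>F z in nhds 0. eval_fps (mom_fps l 1) z = l * Beta (l - z) (1 + z)"
  proof eventually_elim
    case (elim z)
    thus ?case using s[of z] by (auto simp: eval_fps_def sums_iff)
  qed
qed

text \<open>The Taylor series of \<open>\<psi>(1 + z) - \<psi>(l - z)\<close>, the logarithmic derivative of \<open>E e\<^bsup>zX\<^esup>\<close>.\<close>

definition cumulant_fps :: "real \<Rightarrow> real fps" where
  "cumulant_fps l = Abs_fps (\<lambda>n. Polygamma n 1 / fact n) - Abs_fps (\<lambda>n. (-1) ^ n * (Polygamma n l / fact n))"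

text \<open>The arguments \<open>l - z\<close> and \<open>1 + z\<close> have the constant sum
  \<open>l + 1\<close>, so the denominator of the Beta function is free of \<open>z\<close> and the
  logarithmic derivative comes from the two Gamma factors alone.\<close>

lemma fps_deriv_mom_fps:
  assumes l: "l > 0"
  shows "fps_deriv (mom_fps l 1) = mom_fps l 1 * cumulant_fps l"
proof (rule has_fps_expansion_unique)
  let ?f = "\<lambda>z. l * Beta (l - z) (1 + z)" and ?g = "\<lambda>z. Digamma (1 + z) - Digamma (l - z)"
  show "deriv ?f has_fps_expansion fps_deriv (mom_fps l 1)"
    by (intro has_fps_expansion_deriv has_fps_expansion_moment l)
  have "?g has_fps_expansion cumulant_fps l"
    unfolding cumulant_fps_def
    using has_fps_expansion_diff[OF has_fps_expansion_Digamma_real[of 1]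
        has_fps_expansion_uminus_arg[OF has_fps_expansion_Digamma_real[OF l]]] by simp
  hence "(\<lambda>z. ?f z * ?g z) has_fps_expansion mom_fps l 1 * cumulant_fps l"
    by (intro has_fps_expansion_mult has_fps_expansion_moment l)
  moreover have "\<forall>\<^sub>F z in nhds 0. z \<in> {-1<..<l}"
    using l by (intro eventually_nhds_in_open) auto
  hence "\<forall>\<^sub>F z in nhds 0. ?f z * ?g z = deriv ?f z"
  proof eventually_elim
    case (elim z)
    have f: "?f = (\<lambda>z. l / Gamma (l + 1) * (Gamma (l - z) * Gamma (1 + z)))"
      by (simp add: Beta_def fun_eq_iff)
    have "l - z \<notin> \<int>\<^sub>\<le>\<^sub>0" "1 + z \<notin> \<int>\<^sub>\<le>\<^sub>0"
      using elim by (auto elim!: nonpos_Ints_cases)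
    hence "((\<lambda>z. Gamma (l - z) * Gamma (1 + z)) has_field_derivative
            Gamma (l - z) * Gamma (1 + z) * ?g z) (at z)"
      by (auto intro!: derivative_eq_intros simp: algebra_simps)
    hence "((\<lambda>z. l / Gamma (l + 1) * (Gamma (l - z) * Gamma (1 + z))) has_field_derivative
            (l / Gamma (l + 1) * (Gamma (l - z) * Gamma (1 + z))) * ?g z) (at z)"
      unfolding mult.assoc[of "l / Gamma (l + 1)"] by (rule DERIV_cmult)
    moreover have "?f z = l / Gamma (l + 1) * (Gamma (l - z) * Gamma (1 + z))"
      using f by (rule fun_cong)
    ultimately have "(?f has_field_derivative ?f z * ?g z) (at z)"
      unfolding f by simp
    thus ?case by (simp add: DERIV_imp_deriv)
  qed
  ultimately show "deriv ?f has_fps_expansion mom_fps l 1 * cumulant_fps l"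
    unfolding has_fps_expansion_def by (auto elim: eventually_elim2)
qed

section \<open>Newton's recursion\<close>

text \<open>\<open>E\<close> is the generating series of the centred variable and \<open>Q\<close>
  its logarithmic derivative. Comparing coefficients in \<open>E' = E Q\<close> expresses each
  coefficient of \<open>Q\<close> by earlier ones; as \<open>E\<close> has constant term 1, no
  division occurs.\<close>

lemma cumulant_in_Dring:
  assumes l: "l > 0"
  defines "c \<equiv> lgt_moment l 1 1"
  shows "fps_nth (cumulant_fps l - fps_const c) j \<in> Dring l"
proof -
  define E Q where "E = mom_fps l 1 * fps_exp (- c)" and "Q = cumulant_fps l - fps_const c"
  \<comment> \<open>Setting \<open>z = 0\<close> in the moment series yields the total mass,
    \<open>l * Beta l 1 = 1\<close>.\<close>
  have "(\<lambda>i. lgt_moment l i 1 / fact i * 0 ^ i) sums (l * Beta l 1)"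
    using lgt_moment_sums[OF l, of 0] l by simp
  moreover have "(\<lambda>i. lgt_moment l i 1 / fact i * 0 ^ i) sums (lgt_moment l 0 1 / fact 0)"
    using powser_sums_zero[of "\<lambda>i. lgt_moment l i 1 / fact i"] by simp
  ultimately have "lgt_moment l 0 1 = l * Beta l 1" using sums_unique2 by fastforce
  also have "\<dots> = 1"
  proof -
    have "Gamma (l + 1) = l * Gamma l"
      using l by (intro Gamma_plus1) (auto elim!: nonpos_Ints_cases)
    moreover have "Gamma l \<noteq> 0" using Gamma_real_pos[OF l] by (rule less_imp_neq[symmetric])
    ultimately show ?thesis using l by (simp add: Beta_def)
  qed
  finally have m0: "lgt_moment l 0 1 = 1" .
  have E0: "fps_nth E 0 = 1" by (simp add: E_def mom_fps_def m0)
  have E1: "fps_nth E 1 = 0" by (simp add: E_def mom_fps_def m0 fps_mult_nth c_def)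
  have E: "fps_nth E n \<in> Dring l" for n
  proof -
    \<comment> \<open>The limit formula starts at order 2; centring makes the two lowest
      coefficients 1 and 0.\<close>
    consider "n = 0" | "n = 1" | k where "n = Suc (Suc k)" by (metis not0_implies_Suc One_nat_def)
    thus ?thesis
    proof cases
      case (3 k)
      obtain d where d: "d \<in> Dring l" "(central_comb l (Suc (Suc k)) \<longlongrightarrow> d) (at_left 1)"
        using central_comb_tendsto_Dring[OF l] by blast
      have "fps_nth E n = d"
        using tendsto_unique[OF _ central_comb_tendsto_moment[OF l] d(2)] by (simp add: 3 E_def c_def)
      thus ?thesis using d by simp
    qed (use E0 E1 Dring_0 Dring_1 in auto)
  qed
  have "fps_deriv E = E * Q"
  proof -
    have "m * (- k * e) + m * q * e = m * e * (q - k)" for m k e q :: "real fps"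
      by (simp add: algebra_simps)
    thus ?thesis
      unfolding E_def Q_def fps_deriv_mult fps_deriv_mom_fps[OF l] fps_exp_deriv fps_const_neg[symmetric] .
  qed
  hence rec: "real (Suc n) * fps_nth E (Suc n) = (\<Sum>i\<le>n. fps_nth Q i * fps_nth E (n - i))" for n
  proof -
    assume "fps_deriv E = E * Q"
    hence "fps_nth (fps_deriv E) n = fps_nth (Q * E) n" by (simp add: mult.commute)
    thus ?thesis by (simp add: fps_mult_nth[of Q] atLeast0AtMost)
  qed
  have "fps_nth Q j \<in> Dring l"
  proof (induction j rule: less_induct)
    case (less j)
    \<comment> \<open>The recursion is solved for its summand \<open>i = j\<close>, whose cofactor
      is \<open>fps_nth E 0 = 1\<close>.\<close>
    have "fps_nth Q j = real (Suc j) * fps_nth E (Suc j) - (\<Sum>i<j. fps_nth Q i * fps_nth E (j - i))"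
      unfolding rec by (simp add: E0 lessThan_Suc_atMost[symmetric])
    also have "\<dots> \<in> Dring l"
      by (intro Dring_diff Dring_sum Dring_mult l less Dring_of_nat E) auto
    finally show ?case .
  qed
  thus ?thesis unfolding Q_def .
qed

text \<open>For \<open>j = k - 1\<close> the Polygamma value carries the sign \<open>(-1)^k\<close>.
  In the second series the factor \<open>(-1)^j\<close> from the argument \<open>l - z\<close> and
  the subtraction turn this into a plus.\<close>

lemma cumulant_fps_nth:
  assumes l: "l > 0" and k: "k \<ge> 2"
  shows "fps_nth (cumulant_fps l) (k - 1) =
           (-1) ^ k * (\<Sum>n. 1 / real (Suc n) ^ k) + (\<Sum>n. 1 / (real n + l) ^ k)"
proof -
  \<comment> \<open>\<open>j > 0\<close> excludes \<open>Polygamma 0\<close>, the Digamma function,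
    which is not given by the series below.\<close>
  obtain j where j: "k = Suc j" "j > 0" using k by (cases k) auto
  have P: "Polygamma j z / fact j = (-1) ^ Suc j * (\<Sum>n. 1 / (real n + z) ^ k)" for z :: real
    using j by (simp add: Polygamma_def inverse_eq_divide add.commute del: power_Suc)
  have "(-1) ^ j * (Polygamma j l / fact j) = - (\<Sum>n. 1 / (real n + l) ^ k)"
    unfolding P by simp
  thus ?thesis unfolding cumulant_fps_def using P[of 1] j by (simp add: add.commute)
qed

theorem theorem4p30:
  fixes k :: nat
  assumes "k \<ge> 2"
  shows "(\<Sum>n. 1 / real (Suc n) ^ k) \<in> (\<Inter>\<mu>\<in>{0<..}. Z_space \<mu>)"
proof
  fix \<mu> :: real assume "\<mu> \<in> {0<..}"
  hence mu: "\<mu> > 0" by simp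
  let ?z = "\<Sum>n. 1 / real (Suc n) ^ k" and ?s = "\<Sum>n. 1 / (real n + 1 / \<mu>) ^ k"
  have l: "1 / \<mu> > 0" using mu by simp
  \<comment> \<open>Subtracting the mean changes only the coefficient of index 0, and
    \<open>k - 1 \<ge> 1\<close>.\<close>
  have "(-1) ^ k * ?z + ?s = fps_nth (cumulant_fps (1 / \<mu>) - fps_const (lgt_moment (1 / \<mu>) 1 1)) (k - 1)"
    using cumulant_fps_nth[OF l assms] assms by simp
  also have "\<dots> \<in> Z_space \<mu>"
    by (intro Dring_subset_Z_space mu cumulant_in_Dring l)
  finally have "(-1) ^ k * ?z + ?s - ?s \<in> Z_space \<mu>"
    by (intro Z_space_diff shifted_zeta_in_Z_space mu assms)
  \<comment> \<open>A second factor \<open>(-1)^k\<close>, a rational scalar, removes the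
    sign.\<close>
  hence "of_rat ((-1) ^ k) * ((-1) ^ k * ?z) \<in> Z_space \<mu>"
    using Z_space_scale[OF rat_adjoin_const] by simp
  also have "of_rat ((-1) ^ k) * ((-1) ^ k * ?z) = ?z"
    by (simp add: of_rat_power of_rat_minus flip: mult.assoc power_mult_distrib)
  finally show "?z \<in> Z_space \<mu>" .
qed

end
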